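(* Let $\gamma$ be a list representing an element of $\pi_1(D\setminus K,u)$ which is an element of the standard g-base after the action of a braid. Then the algorithm PathToSyntactic, run on input $\gamma$, returns a word in $\{\gamma_1,\dots,\gamma_n,\gamma_1^{-1},\dots,\gamma_n^{-1}\}$ (the elements of the standard g-base and their inverses) that represents the same element of the fundamental group $\pi_1(D\setminus K,u)$ as the one represented by the list $\gamma$.
   Context: **Fundamental group and g-bases.** $D$ is the closed unit disk with counterclockwise (positive) orientation, $u=(0,-1)$, and $K=\{k_1,\dots,k_n\}$ is a set of $n$ points of the interior of $D$ on the $x$-axis, numbered from left to right. Loops in $\pi_1(D\setminus K,u)$ are concatenated from left to right. For a simple path $q$ from $u$ to $k_i$ meeting $K$ only at $k_i$, $l(q)=q'\cup c\cup q'^{-1}\in\pi_1(D\setminus K,u)$, where $c$ is the positively oriented boundary of a small neighbourhood $V$ of $k_i$ and $q'=q\setminus(V\cap q)$. The standard g-base is $(\gamma_1,\dots,\gamma_n)$, $\gamma_i=l(T_i)$ with $T_i$ the straight segment from $u$ to $k_i$; it freely generates $\pi_1(D\setminus K,u)$. **Braids.** The braid group $B_n[D,K]$ is the group of diffeomorphisms $\beta$ of $D$ with $\beta(K)=K$, $\beta|_{\partial D}=\mathrm{Id}$, modulo identification of those inducing the same automorphism of $\pi_1(D\setminus K,u)$. An element of the standard g-base after the action of a braid is the image of some $\gamma_j$ under the automorphism induced by a braid; it equals $l(T)$ for a simple path $T$ from $u$ to some $k_i$. **Encoding of paths by lists.** A link is a pair (Point, Position). The link $(i,1)$ denotes a point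 close to $k_i$ and above it, $(i,-1)$ a point close to $k_i$ and below it, $(i,0)$ the point $k_i$ itself, and $(-1,0)$ denotes $u$. A path $T$ from $u$ to $k_i$ is encoded by a list of links starting with $(-1,0)$ and ending with $(i,0)$, all intermediate links having position $\pm1$. The link $(-1,0)$ is never followed by a link $(i,-1)$. After the second link, consecutive links have points differing by at most $1$. The path is obtained by joining the successive positions as follows. - Between links over neighbouring points $k_i$ and $k_{i\pm1}$, the path goes directly from one position to the other. - Two consecutive links $(i,e)\to(i,-e)$ over the same point occur only where the path switches direction around $k_i$; the path then rounds $k_i$ on the side opposite to that of the link following the pair. - A start $(-1,0)\to(i,1)$ goes up from $u$ to the position above $k_i$. It passes to the right of $k_i$ if it continues $(i-1,e)$, and to the left of $k_i$ if it continues $(i+1,e)$. If it continues $(i,-1)\to(i+1,e)$ it passes to the right of $k_i$, and if it continues $(i,-1)\to(i-1,e)$ it passes to the left of $k_i$. - A start $(-1,0)\to(i,0)$ is the straight segment $T_i$. Lists are kept in reduced form (no superfluous links or backtracking). The list represents the element $l(T)\in\pi_1(D\setminus K,u)$; the way back from $k_i$ is not recorded. **Algorithm PathToSyntactic($\gamma$).** Start with the empty word $w$. Go over the links $L$ of the list in order, other than the links $(-1,0)$. Let NextLink be the link after $L$ and SecondLink the link after NextLink. - If $L=(i,0)$, append $\gamma_i$ to $w$. - If $L=(i,-1)$, append nothing. - If $L=(i,1)$ and NextLink has point $i-1$, append $\gamma_i$. - If $L=(i,1)$ and NextLink has point $i+1$, append $\gamma_i^{-1}$. - If $L=(i,1)$,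 NextLink has point $i$ and SecondLink has point $i-1$, append $\gamma_i^{-1}$. - If $L=(i,1)$, NextLink has point $i$ and SecondLink has point $i+1$, append $\gamma_i$. After the pass, let $l$ be the length of $w$; for $m=l-1,l-2,\dots,1$ append to $w$ the inverse of the $m$-th letter of $w$. Return $w$. *)

theory Defs
  imports "HOL-Analysis.Analysis" "HOL-Algebra.Group"
begin

section \<open>The fundamental group\<close>

definition pi1_class :: "'a::real_normed_vector set \<Rightarrow> (real \<Rightarrow> 'a) \<Rightarrow> (real \<Rightarrow> 'a) set" where
  "pi1_class S g = {h. homotopic_paths S g h}"

definition pi1 :: "'a::real_normed_vector set \<Rightarrow> 'a \<Rightarrow> (real \<Rightarrow> 'a) set monoid" where
  "pi1 S x = \<lparr>
     carrier = {pi1_class S g | g.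
        path g \<and> path_image g \<subseteq> S \<and> pathstart g = x \<and> pathfinish g = x},
     mult = (\<lambda>A B. {h. \<exists>p\<in>A. \<exists>q\<in>B. homotopic_paths S (p +++ q) h}),
     one = pi1_class S (linepath x x)\<rparr>"

definition pi1_map ::
    "'a::real_normed_vector set \<Rightarrow> ('a \<Rightarrow> 'a) \<Rightarrow> (real \<Rightarrow> 'a) set \<Rightarrow> (real \<Rightarrow> 'a) set" where
  "pi1_map S f A = {h. \<exists>g\<in>A. homotopic_paths S (f \<circ> g) h}"

lemma pi1_class_eqI: "homotopic_paths S g h \<Longrightarrow> pi1_class S g = pi1_class S h"
  unfolding pi1_class_def by (blast intro: homotopic_paths_sym homotopic_paths_trans)

lemma pi1_mult_class:
  assumes "path g" "path_image g \<subseteq> S" "path h" "path_image h \<subseteq> S" "pathfinish g = pathstart h"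
  shows "pi1_class S g \<otimes>\<^bsub>pi1 S x\<^esub> pi1_class S h = pi1_class S (g +++ h)"
proof -
  have "homotopic_paths S (g +++ h) r"
    if "homotopic_paths S g p" "homotopic_paths S h q" "homotopic_paths S (p +++ q) r" for p q r
    using that homotopic_paths_join[OF that(1,2)] assms(5) by (blast intro: homotopic_paths_trans)
  moreover have "homotopic_paths S g g" "homotopic_paths S h h"
    using assms by auto
  ultimately show ?thesis
    unfolding pi1_def pi1_class_def by (simp, blast)
qed

lemma group_pi1:
  assumes "x \<in> S"
  shows "group (pi1 S x)"
proof (rule groupI)
  let ?loop = "\<lambda>g. path g \<and> path_image g \<subseteq> S \<and> pathstart g = x \<and> pathfinish g = x"
  have car: "A \<in> carrier (pi1 S x) \<longleftrightarrow> (\<exists>g. A = pi1_class S g \<and> ?loop g)" for A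
    by (simp add: pi1_def)
  have one: "\<one>\<^bsub>pi1 S x\<^esub> = pi1_class S (linepath x x)"
    by (simp add: pi1_def)
  show "\<one>\<^bsub>pi1 S x\<^esub> \<in> carrier (pi1 S x)"
    unfolding one car using assms by (intro exI[of _ "linepath x x"]) auto
  fix A assume "A \<in> carrier (pi1 S x)"
  then obtain f where f: "A = pi1_class S f" "?loop f" by (auto simp: car)
  show "\<one>\<^bsub>pi1 S x\<^esub> \<otimes>\<^bsub>pi1 S x\<^esub> A = A"
    unfolding one f using f assms
    by (subst pi1_mult_class) (auto intro!: pi1_class_eqI homotopic_paths_lid')
  have "pi1_class S (reversepath f) \<otimes>\<^bsub>pi1 S x\<^esub> A = \<one>\<^bsub>pi1 S x\<^esub>"
    unfolding one f using f homotopic_paths_linv[of f S]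
    by (subst pi1_mult_class) (auto intro!: pi1_class_eqI)
  moreover have "pi1_class S (reversepath f) \<in> carrier (pi1 S x)"
    unfolding car using f by (intro exI[of _ "reversepath f"]) auto
  ultimately show "\<exists>B\<in>carrier (pi1 S x). B \<otimes>\<^bsub>pi1 S x\<^esub> A = \<one>\<^bsub>pi1 S x\<^esub>" by blast
  fix B assume "B \<in> carrier (pi1 S x)"
  then obtain g where g: "B = pi1_class S g" "?loop g" by (auto simp: car)
  have AB: "A \<otimes>\<^bsub>pi1 S x\<^esub> B = pi1_class S (f +++ g)"
    unfolding f g using f g by (intro pi1_mult_class) auto
  show "A \<otimes>\<^bsub>pi1 S x\<^esub> B \<in> carrier (pi1 S x)"
    unfolding AB car using f g
    by (intro exI[of _ "f +++ g"]) (auto simp: path_image_join)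
  fix C assume "C \<in> carrier (pi1 S x)"
  then obtain h where h: "C = pi1_class S h" "?loop h" by (auto simp: car)
  have BC: "B \<otimes>\<^bsub>pi1 S x\<^esub> C = pi1_class S (g +++ h)"
    unfolding h g using h g by (intro pi1_mult_class) auto
  have "(A \<otimes>\<^bsub>pi1 S x\<^esub> B) \<otimes>\<^bsub>pi1 S x\<^esub> C = pi1_class S ((f +++ g) +++ h)"
    unfolding AB h using f g h by (intro pi1_mult_class) (auto simp: path_image_join)
  also have "\<dots> = pi1_class S (f +++ (g +++ h))"
    using f g h by (intro pi1_class_eqI homotopic_paths_sym[OF homotopic_paths_assoc]) auto
  also have "\<dots> = A \<otimes>\<^bsub>pi1 S x\<^esub> (B \<otimes>\<^bsub>pi1 S x\<^esub> C)"
    unfolding BC f using f g h by (intro pi1_mult_class[symmetric]) (auto simp: path_image_join)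
  finally show "(A \<otimes>\<^bsub>pi1 S x\<^esub> B) \<otimes>\<^bsub>pi1 S x\<^esub> C = A \<otimes>\<^bsub>pi1 S x\<^esub> (B \<otimes>\<^bsub>pi1 S x\<^esub> C)" .
qed


section \<open>The punctured disk and its standard g-base\<close>

text \<open>The plane is \<^typ>\<open>complex\<close>. The \<open>i\<close>-th puncture is \<open>k i\<close> for \<open>1 \<le> i \<le> n\<close>; the
  values of \<open>k\<close> at other indices are irrelevant. Indices are integers because points of links are.\<close>

definition disk :: "complex set" where
  "disk = cball 0 1"

definition base_pt :: complex where
  "base_pt = Complex 0 (-1)"

definition puncture_config :: "nat \<Rightarrow> (int \<Rightarrow> real) \<Rightarrow> bool" where
  "puncture_config n k \<longleftrightarrow>
     strict_mono_on {1..int n} k \<and> (\<forall>i\<in>{1..int n}. Complex (k i) 0 \<in> interior disk)"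

definition punctures :: "nat \<Rightarrow> (int \<Rightarrow> real) \<Rightarrow> complex set" where
  "punctures n k = (\<lambda>i. Complex (k i) 0) ` {1..int n}"

abbreviation punctured_disk :: "nat \<Rightarrow> (int \<Rightarrow> real) \<Rightarrow> complex set" where
  "punctured_disk n k \<equiv> disk - punctures n k"

text \<open>The loop \<open>q' \<union> c \<union> q'\<inverse>\<close> built from a path \<open>q\<close> ending in a puncture \<open>z\<close>, where the
  neighbourhood \<open>V\<close> of \<open>z\<close> is the disk of radius \<open>r\<close>: \<open>q'\<close> is \<open>q\<close> up to the first time it
  meets \<open>V\<close>, and \<open>c\<close> runs once counterclockwise round \<open>V\<close>, starting where \<open>q'\<close> ends.\<close>

definition lasso :: "(real \<Rightarrow> complex) \<Rightarrow> real \<Rightarrow> real \<Rightarrow> complex" where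
  "lasso q r =
     (let z = pathfinish q;
          t = Inf {s \<in> {0..1}. dist (q s) z \<le> r};
          q' = subpath 0 t q;
          c = (\<lambda>s. z + (q t - z) * cis (2 * pi * s))
      in q' +++ (c +++ reversepath q'))"

text \<open>The element \<open>l(q)\<close>: the class of the lasso for every sufficiently small neighbourhood. A
  larger \<open>V\<close> may give a different class, since \<open>q\<close> may leave \<open>V\<close> again and wind round other
  punctures. Should the class fail to stabilise, this set is empty and hence no element of
  the group.\<close>

definition lasso_class :: "complex set \<Rightarrow> (real \<Rightarrow> complex) \<Rightarrow> (real \<Rightarrow> complex) set" where
  "lasso_class S q = {h. \<forall>\<^sub>F r in at_right 0. h \<in> pi1_class S (lasso q r)}"

definition std_gen :: "nat \<Rightarrow> (int \<Rightarrow> real) \<Rightarrow> int \<Rightarrow> (real \<Rightarrow> complex) set" where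
  "std_gen n k i = lasso_class (punctured_disk n k) (linepath base_pt (Complex (k i) 0))"


section \<open>Braids\<close>

text \<open>Differentiability is real (Frechet) differentiability, also for maps of \<^typ>\<open>complex\<close>.\<close>

primrec times_differentiable_on ::
    "nat \<Rightarrow> 'a::real_normed_vector set \<Rightarrow> ('a \<Rightarrow> 'b::real_normed_vector) \<Rightarrow> bool" where
  "times_differentiable_on 0 U f \<longleftrightarrow> continuous_on U f"
| "times_differentiable_on (Suc m) U f \<longleftrightarrow>
     (\<forall>x\<in>U. f differentiable at x) \<and>
     (\<forall>v. times_differentiable_on m U (\<lambda>x. frechet_derivative f (at x) v))"

text \<open>Smoothness on an arbitrary set, in particular on the closed disk, is the existence of a
  smooth extension to an open neighbourhood.\<close>

definition smooth_map_on ::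
    "'a::real_normed_vector set \<Rightarrow> ('a \<Rightarrow> 'b::real_normed_vector) \<Rightarrow> bool" where
  "smooth_map_on A f \<longleftrightarrow>
     (\<exists>U F. open U \<and> A \<subseteq> U \<and> (\<forall>m. times_differentiable_on m U F) \<and> (\<forall>x\<in>A. F x = f x))"

definition diffeomorphism_of ::
    "'a::real_normed_vector set \<Rightarrow> ('a \<Rightarrow> 'a) \<Rightarrow> bool" where
  "diffeomorphism_of A f \<longleftrightarrow>
     bij_betw f A A \<and> smooth_map_on A f \<and> smooth_map_on A (inv_into A f)"

definition braid_diffeos :: "nat \<Rightarrow> (int \<Rightarrow> real) \<Rightarrow> (complex \<Rightarrow> complex) set" where
  "braid_diffeos n k =
     {\<beta>. diffeomorphism_of disk \<beta> \<and> \<beta> ` punctures n k = punctures n k \<and>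
         (\<forall>x\<in>frontier disk. \<beta> x = x)}"

definition braid_rel ::
    "nat \<Rightarrow> (int \<Rightarrow> real) \<Rightarrow> ((complex \<Rightarrow> complex) \<times> (complex \<Rightarrow> complex)) set" where
  "braid_rel n k =
     {(\<beta>, \<beta>'). \<beta> \<in> braid_diffeos n k \<and> \<beta>' \<in> braid_diffeos n k \<and>
        (\<forall>A\<in>carrier (pi1 (punctured_disk n k) base_pt).
           pi1_map (punctured_disk n k) \<beta> A = pi1_map (punctured_disk n k) \<beta>' A)}"

definition braids :: "nat \<Rightarrow> (int \<Rightarrow> real) \<Rightarrow> (complex \<Rightarrow> complex) set set" where
  "braids n k = braid_diffeos n k // braid_rel n k"

definition braid_images_of_gens :: "nat \<Rightarrow> (int \<Rightarrow> real) \<Rightarrow> (real \<Rightarrow> complex) set set" where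
  "braid_images_of_gens n k =
     {pi1_map (punctured_disk n k) \<beta> (std_gen n k j) | b \<beta> j.
        b \<in> braids n k \<and> \<beta> \<in> b \<and> j \<in> {1..int n}}"


section \<open>Encoding of paths by lists of links\<close>

text \<open>A link is a pair (point, position).\<close>

type_synonym link = "int \<times> int"

text \<open>The last three conjuncts say that the list is in reduced form. The first of them treats two
  consecutive links over the same point: they have opposite positions, another link follows, and
  the path switches direction there, that is, it goes on to the neighbour it came from (no
  restriction at the start of the path, where it came from \<open>u\<close>). In particular the final link
  is not preceded by a superfluous link over the same point. The second excludes backtracking:
  without such a pair of links over a point, the path does not switch direction there.\<close>

definition path_code :: "nat \<Rightarrow> link list \<Rightarrow> bool" where
  "path_code n L \<longleftrightarrow>
     length L \<ge> 2 \<and>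
     L ! 0 = (-1, 0) \<and>
     (\<exists>i\<in>{1..int n}. last L = (i, 0)) \<and>
     (\<forall>m. 1 \<le> m \<and> m + 1 < length L \<longrightarrow> fst (L ! m) \<in> {1..int n} \<and> snd (L ! m) \<in> {1, -1}) \<and>
     snd (L ! 1) \<noteq> -1 \<and>
     (\<forall>m. 1 \<le> m \<and> m + 1 < length L \<longrightarrow> \<bar>fst (L ! (m + 1)) - fst (L ! m)\<bar> \<le> 1) \<and>
     (\<forall>m. 1 \<le> m \<and> m + 1 < length L \<and> fst (L ! (m + 1)) = fst (L ! m) \<longrightarrow>
        snd (L ! (m + 1)) = - snd (L ! m) \<and>
        m + 2 < length L \<and> fst (L ! (m + 2)) \<noteq> fst (L ! m) \<and>
        (2 \<le> m \<longrightarrow> fst (L ! (m - 1)) = fst (L ! (m + 2)))) \<and>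
     (\<forall>m. 2 \<le> m \<and> m + 1 < length L \<and>
        fst (L ! (m - 1)) \<noteq> fst (L ! m) \<and> fst (L ! m) \<noteq> fst (L ! (m + 1)) \<longrightarrow>
        fst (L ! (m - 1)) \<noteq> fst (L ! (m + 1)))"

text \<open>The number \<open>\<epsilon>\<close> measures how close to the punctures the positions of links are.\<close>

definition link_pt :: "(int \<Rightarrow> real) \<Rightarrow> real \<Rightarrow> link \<Rightarrow> complex" where
  "link_pt k \<epsilon> L =
     (if L = (-1, 0) then base_pt else Complex (k (fst L)) (real_of_int (snd L) * \<epsilon>))"

definition left_of :: "(int \<Rightarrow> real) \<Rightarrow> real \<Rightarrow> int \<Rightarrow> complex" where
  "left_of k \<epsilon> i = Complex (k i - \<epsilon>) 0"

definition right_of :: "(int \<Rightarrow> real) \<Rightarrow> real \<Rightarrow> int \<Rightarrow> complex" where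
  "right_of k \<epsilon> i = Complex (k i + \<epsilon>) 0"

text \<open>Intermediate points visited between \<open>u\<close> and the link \<open>(i,1)\<close>, where \<open>rest\<close> is what follows
  \<open>(i,1)\<close>: they decide on which side of \<open>k i\<close> the path goes up.\<close>

definition start_detour :: "(int \<Rightarrow> real) \<Rightarrow> real \<Rightarrow> int \<Rightarrow> link list \<Rightarrow> complex list" where
  "start_detour k \<epsilon> i rest =
     (case rest of
        [] \<Rightarrow> []
      | (j, _) # rest' \<Rightarrow>
          if j = i - 1 then [right_of k \<epsilon> i]
          else if j = i + 1 then [left_of k \<epsilon> i]
          else (case rest' of
                  [] \<Rightarrow> []
                | (j', _) # _ \<Rightarrow>
                    if j' = i + 1 then [right_of k \<epsilon> i]
                    else if j' = i - 1 then [left_of k \<epsilon> i]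
                    else []))"

text \<open>Intermediate points visited between \<open>(i,e)\<close> and \<open>(i,-e)\<close>, followed by \<open>rest\<close>.\<close>

definition turn_detour :: "(int \<Rightarrow> real) \<Rightarrow> real \<Rightarrow> int \<Rightarrow> link list \<Rightarrow> complex list" where
  "turn_detour k \<epsilon> i rest =
     (case rest of
        [] \<Rightarrow> []
      | (j, _) # _ \<Rightarrow>
          if j = i + 1 then [left_of k \<epsilon> i]
          else if j = i - 1 then [right_of k \<epsilon> i]
          else [])"

definition detour :: "(int \<Rightarrow> real) \<Rightarrow> real \<Rightarrow> link \<Rightarrow> link \<Rightarrow> link list \<Rightarrow> complex list" where
  "detour k \<epsilon> a b rest =
     (if a = (-1, 0) then (if snd b = 1 then start_detour k \<epsilon> (fst b) rest else [])
      else if fst a = fst b then turn_detour k \<epsilon> (fst a) rest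
      else [])"

fun vertices :: "(int \<Rightarrow> real) \<Rightarrow> real \<Rightarrow> link list \<Rightarrow> complex list" where
  "vertices k \<epsilon> [] = []"
| "vertices k \<epsilon> [a] = [link_pt k \<epsilon> a]"
| "vertices k \<epsilon> (a # b # rest) =
     link_pt k \<epsilon> a # detour k \<epsilon> a b rest @ vertices k \<epsilon> (b # rest)"

fun polygonal_path :: "complex list \<Rightarrow> real \<Rightarrow> complex" where
  "polygonal_path [] = linepath 0 0"
| "polygonal_path [a] = linepath a a"
| "polygonal_path [a, b] = linepath a b"
| "polygonal_path (a # b # c # vs) = linepath a b +++ polygonal_path (b # c # vs)"

text \<open>The path drawn from a list. Strands of the path over the same link are drawn on top of each
  other rather than side by side, which affects neither its homotopy class nor \<open>l(T)\<close>.\<close>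

definition code_path :: "(int \<Rightarrow> real) \<Rightarrow> link list \<Rightarrow> real \<Rightarrow> real \<Rightarrow> complex" where
  "code_path k L \<epsilon> = polygonal_path (vertices k \<epsilon> L)"

text \<open>The element \<open>l(T)\<close> represented by a list, with the positions sufficiently close to the
  punctures.\<close>

definition code_class :: "nat \<Rightarrow> (int \<Rightarrow> real) \<Rightarrow> link list \<Rightarrow> (real \<Rightarrow> complex) set" where
  "code_class n k L =
     {h. \<forall>\<^sub>F \<epsilon> in at_right 0. h \<in> lasso_class (punctured_disk n k) (code_path k L \<epsilon>)}"


section \<open>Words and the algorithm\<close>

datatype letter = Gen int | GenInv int

primrec letter_index :: "letter \<Rightarrow> int" where
  "letter_index (Gen i) = i"
| "letter_index (GenInv i) = i"

primrec inverse_letter :: "letter \<Rightarrow> letter" where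
  "inverse_letter (Gen i) = GenInv i"
| "inverse_letter (GenInv i) = Gen i"

primrec letter_value :: "nat \<Rightarrow> (int \<Rightarrow> real) \<Rightarrow> letter \<Rightarrow> (real \<Rightarrow> complex) set" where
  "letter_value n k (Gen i) = std_gen n k i"
| "letter_value n k (GenInv i) = inv\<^bsub>pi1 (punctured_disk n k) base_pt\<^esub> (std_gen n k i)"

definition word_value :: "nat \<Rightarrow> (int \<Rightarrow> real) \<Rightarrow> letter list \<Rightarrow> (real \<Rightarrow> complex) set" where
  "word_value n k w =
     foldr (\<lambda>x A. letter_value n k x \<otimes>\<^bsub>pi1 (punctured_disk n k) base_pt\<^esub> A) w
       \<one>\<^bsub>pi1 (punctured_disk n k) base_pt\<^esub>"

text \<open>What is appended for the link \<open>(i,e)\<close> when \<open>rest\<close> follows it. The cases with result \<open>[]\<close>,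
  other than \<open>e = -1\<close>, do not occur for lists satisfying \<^const>\<open>path_code\<close>.\<close>

definition link_letters :: "link \<Rightarrow> link list \<Rightarrow> letter list" where
  "link_letters L rest =
     (case L of (i, e) \<Rightarrow>
        if e = 0 then [Gen i]
        else if e = -1 then []
        else (case rest of
                [] \<Rightarrow> []
              | (j, _) # rest' \<Rightarrow>
                  if j = i - 1 then [Gen i]
                  else if j = i + 1 then [GenInv i]
                  else if j = i then
                    (case rest' of
                       [] \<Rightarrow> []
                     | (j', _) # _ \<Rightarrow>
                         if j' = i - 1 then [GenInv i]
                         else if j' = i + 1 then [Gen i]
                         else [])
                  else []))"

fun link_pass :: "link list \<Rightarrow> letter list" where
  "link_pass [] = []"
| "link_pass (L # rest) = (if L = (-1, 0) then [] else link_letters L rest) @ link_pass rest"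

definition path_to_syntactic :: "link list \<Rightarrow> letter list" where
  "path_to_syntactic L = (let w = link_pass L in w @ map inverse_letter (rev (butlast w)))"

end

theory Submission
  imports Defs
begin

text \<open>Cut the plane along a vertical ray upwards from each puncture. What remains of the disk is simply
connected, and a path from the base point is determined up to homotopy by the rays that it crosses:
crossing the ray of the \<open>i\<close>-th puncture from right to left contributes \<open>\<gamma>\<^sub>i\<close>, crossing it from left
to right contributes \<open>\<gamma>\<^sub>i\<inverse>\<close>. A coded path meets the ray of \<open>i\<close> only at links \<open>(i,1)\<close>, and because the
list is reduced, it leaves every link on the side opposite to the one where it came in. Hence the
links that follow \<open>(i,1)\<close> tell the direction of the crossing; this is the case distinction
of the algorithm. The lasso of the whole path is the word \<open>w\<close> of these crossings, then the small circle
round the last puncture approached from below, which is \<open>\<gamma>\<^sub>i\<close>, and then the way back, \<open>w\<inverse>\<close>.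

The bookkeeping is done in a fundamental groupoid. Each point is tied to the base point by a tether,
a straight one if possible, and \<open>based g\<close> is the class of the path \<open>g\<close> closed up by the
tethers of its two ends. This turns composition of paths into multiplication in the fundamental group
(\<open>based_join\<close>), depends only on the homotopy class, and is trivial on convex regions that contain
the base point (\<open>based_in_star\<close>), in particular on the lower half of the disk. A polygon therefore
has as its value the product of the values of its edges, and only the edges next to a position above a
puncture matter.

Three facts carry the proof. The lasso of a polygon that ends in a puncture is a conjugate of a
fixed circle round the puncture, the conjugating element being the value of the polygon redirected to the point
below the puncture (\<open>lasso_class_polygonal_path\<close>). The circle round the \<open>i\<close>-th puncture is
the product of the two edges that pass over it from right to left (\<open>std_gen_over\<close>). Finally, by
induction over the suffixes of the list, with the last link \<open>(i,0)\<close> replaced by \<open>(i,-1)\<close>, the value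
of the polygon is the word collected by the algorithm (\<open>walk_value\<close>). The induction works because a
suffix, preceded by \<open>(-1,0)\<close>, is again drawn as a path from the base point, and the detour prescribed
for its start passes the first puncture on the side from which the original path arrives.\<close>


section \<open>Values of paths in the fundamental group\<close>

abbreviation path_in :: "'a::topological_space set \<Rightarrow> (real \<Rightarrow> 'a) \<Rightarrow> bool" where
  "path_in S g \<equiv> path g \<and> path_image g \<subseteq> S"

lemma homotopic_paths_in_convex:
  fixes C :: "'a::real_normed_vector set"
  assumes "convex C" "C \<subseteq> S" "path_in C g" "path_in C h"
    "pathstart g = pathstart h" "pathfinish g = pathfinish h"
  shows "homotopic_paths S g h"
proof (rule homotopic_paths_linear)
  fix t :: real assume "t \<in> {0..1}"
  then have "g t \<in> C" "h t \<in> C" using assms by (auto simp: path_image_def)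
  then show "closed_segment (g t) (h t) \<subseteq> S"
    using assms(1,2) closed_segment_subset by blast
qed (use assms in auto)

text \<open>Two tethered paths are concatenated; the tether \<open>t\<close> at their common point is run back and forth.\<close>

lemma homotopic_join_cancel_middle:
  fixes S :: "'a::real_normed_vector set"
  assumes "path_in S f" "path_in S g" "path_in S t" "path_in S h" "path_in S e"
    "pathfinish f = pathstart g" "pathfinish g = pathfinish t" "pathstart h = pathfinish t"
    "pathfinish h = pathstart e"
  shows "homotopic_paths S ((f +++ (g +++ reversepath t)) +++ (t +++ (h +++ e))) (f +++ ((g +++ h) +++ e))"
proof -
  have "homotopic_paths S ((f +++ (g +++ reversepath t)) +++ (t +++ (h +++ e)))
      (f +++ ((g +++ reversepath t) +++ (t +++ (h +++ e))))"
    using assms by (intro homotopic_paths_sym[OF homotopic_paths_assoc]) (auto simp: path_image_join)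
  also have "homotopic_paths S \<dots> (f +++ (g +++ (reversepath t +++ (t +++ (h +++ e)))))"
    using assms
    by (intro homotopic_paths_join homotopic_paths_sym[OF homotopic_paths_assoc]) (auto simp: path_image_join)
  also have "homotopic_paths S \<dots> (f +++ (g +++ ((reversepath t +++ t) +++ (h +++ e))))"
    using assms by (intro homotopic_paths_join homotopic_paths_assoc) (auto simp: path_image_join)
  also have "homotopic_paths S \<dots>
      (f +++ (g +++ (linepath (pathfinish t) (pathfinish t) +++ (h +++ e))))"
    using assms by (intro homotopic_paths_join homotopic_paths_linv) (auto simp: path_image_join)
  also have "homotopic_paths S \<dots> (f +++ (g +++ (h +++ e)))"
    using assms by (intro homotopic_paths_join homotopic_paths_lid') (auto simp: path_image_join)
  also have "homotopic_paths S \<dots> (f +++ ((g +++ h) +++ e))"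
    using assms by (intro homotopic_paths_join homotopic_paths_assoc) (auto simp: path_image_join)
  finally show ?thesis .
qed

text \<open>The polygon with the vertices \<open>vs\<close> lies in \<open>T\<close>, in a form that unfolds along the list.\<close>

fun edges_in :: "'a::real_normed_vector set \<Rightarrow> 'a list \<Rightarrow> bool" where
  "edges_in T [] \<longleftrightarrow> True"
| "edges_in T [a] \<longleftrightarrow> a \<in> T"
| "edges_in T (a # b # vs) \<longleftrightarrow> closed_segment a b \<subseteq> T \<and> edges_in T (b # vs)"

lemma edges_in_butlast: "edges_in T (vs @ [x]) \<Longrightarrow> edges_in T vs"
  by (induction T vs rule: edges_in.induct) auto

text \<open>Segments are compact, hence have positive distance from a point outside them.\<close>

lemma eventually_edges_avoid:
  fixes z :: complex
  assumes "edges_in (- {z}) vs"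
  shows "\<forall>\<^sub>F r in at_right 0. edges_in (- cball z r) vs"
proof -
  have far: "\<forall>\<^sub>F r in at_right (0::real). closed_segment a b \<subseteq> - cball z r"
    if "z \<notin> closed_segment a b" for a b
  proof -
    have "closed (closed_segment a b)" by (intro compact_imp_closed compact_segment)
    from separate_point_closed[OF this that]
    obtain d where d: "d > 0" "\<And>x. x \<in> closed_segment a b \<Longrightarrow> d \<le> dist z x" by blast
    have "closed_segment a b \<subseteq> - cball z r" if "r < d" for r
      using d(2) that by force
    then show ?thesis using d(1) unfolding eventually_at_right_field by blast
  qed
  show ?thesis using assms
  proof (induction "- {z}" vs rule: edges_in.induct)
    case (2 a)
    then show ?case using far[of a a] by (auto elim: eventually_mono)
  next
    case (3 a b vs)
    then show ?case using far[of a b] by (auto intro: eventually_conj)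
  qed auto
qed

lemma edges_in_mono: "edges_in T vs \<Longrightarrow> T \<subseteq> T' \<Longrightarrow> edges_in T' vs"
  by (induction T vs rule: edges_in.induct) auto

lemma edges_in_last: "edges_in T vs \<Longrightarrow> vs \<noteq> [] \<Longrightarrow> last vs \<in> T"
  by (induction T vs rule: edges_in.induct) auto

locale based_space =
  fixes S :: "'a::real_normed_vector set" and u :: 'a
  assumes path_connected: "path_connected S" and base_in: "u \<in> S"
begin

sublocale group "pi1 S u"
  by (rule group_pi1[OF base_in])

text \<open>The straight choice is what makes \<open>based\<close> trivial on convex regions that contain the base
point. For other points any choice will do, since tethers at interior vertices of a polygon cancel.\<close>

definition tether :: "'a \<Rightarrow> real \<Rightarrow> 'a" where
  "tether a = (if closed_segment u a \<subseteq> S then linepath u a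
     else SOME g. path_in S g \<and> pathstart g = u \<and> pathfinish g = a)"

lemma tether:
  assumes "a \<in> S"
  shows "path (tether a)" "path_image (tether a) \<subseteq> S"
    "pathstart (tether a) = u" "pathfinish (tether a) = a"
proof -
  have "\<exists>g. path_in S g \<and> pathstart g = u \<and> pathfinish g = a"
    using path_connected base_in assms unfolding path_connected_def by blast
  from someI_ex[OF this]
  have "path_in S (tether a) \<and> pathstart (tether a) = u \<and> pathfinish (tether a) = a"
    by (auto simp: tether_def)
  then show "path (tether a)" "path_image (tether a) \<subseteq> S"
    "pathstart (tether a) = u" "pathfinish (tether a) = a" by auto
qed

definition based :: "(real \<Rightarrow> 'a) \<Rightarrow> (real \<Rightarrow> 'a) set" where
  "based g = pi1_class S (tether (pathstart g) +++ (g +++ reversepath (tether (pathfinish g))))"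

lemma ends_in:
  assumes "path_in S g" shows "pathstart g \<in> S" "pathfinish g \<in> S"
  using assms pathstart_in_path_image pathfinish_in_path_image by blast+

lemma based_closed [simp]:
  assumes "path_in S g" shows "based g \<in> carrier (pi1 S u)"
proof -
  note t = tether[OF ends_in(1)[OF assms]] tether[OF ends_in(2)[OF assms]]
  let ?l = "tether (pathstart g) +++ (g +++ reversepath (tether (pathfinish g)))"
  have "path_in S ?l \<and> pathstart ?l = u \<and> pathfinish ?l = u"
    using assms t by (simp add: path_image_join)
  then show ?thesis unfolding based_def pi1_def by auto
qed

lemma based_cong:
  assumes "homotopic_paths S g h" shows "based g = based h"
proof -
  have "path_in S g" "path_in S h"
    using assms homotopic_paths_imp_path homotopic_paths_imp_subset by blast+
  moreover have "pathstart g = pathstart h" "pathfinish g = pathfinish h"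
    using assms homotopic_paths_imp_pathstart homotopic_paths_imp_pathfinish by blast+
  ultimately show ?thesis unfolding based_def
    using assms tether[OF ends_in(1)[OF \<open>path_in S h\<close>]] tether[OF ends_in(2)[OF \<open>path_in S h\<close>]]
    by (auto intro!: pi1_class_eqI homotopic_paths_join)
qed

lemma based_join:
  assumes "path_in S g" "path_in S h" "pathfinish g = pathstart h"
  shows "based (g +++ h) = based g \<otimes>\<^bsub>pi1 S u\<^esub> based h"
proof -
  note t = tether[OF ends_in(1)[OF assms(1)]] tether[OF ends_in(2)[OF assms(1)]]
    tether[OF ends_in(2)[OF assms(2)]]
  have "based g \<otimes>\<^bsub>pi1 S u\<^esub> based h = pi1_class S
    ((tether (pathstart g) +++ (g +++ reversepath (tether (pathfinish g)))) +++
     (tether (pathfinish g) +++ (h +++ reversepath (tether (pathfinish h)))))"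
    unfolding based_def assms(3)[symmetric] using assms t
    by (intro pi1_mult_class) (auto simp: path_image_join)
  also have "\<dots> = based (g +++ h)"
    unfolding based_def using assms t
    by (intro pi1_class_eqI) (auto intro!: homotopic_join_cancel_middle)
  finally show ?thesis ..
qed

lemma based_loop:
  assumes "path_in S g" "pathstart g = u" "pathfinish g = u"
  shows "based g = pi1_class S g"
proof -
  have "tether u = linepath u u" using base_in by (simp add: tether_def)
  then show ?thesis unfolding based_def using assms base_in
    by (intro pi1_class_eqI)
      (auto intro!: homotopic_paths_trans[OF homotopic_paths_lid'] homotopic_paths_rid'
        simp: path_image_join)
qed

lemma one_eq: "\<one>\<^bsub>pi1 S u\<^esub> = pi1_class S (linepath u u)"
  by (simp add: pi1_def)

text \<open>All tethers to points of \<open>C\<close> are straight and run inside \<open>C\<close>, so the loop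
stays in a convex set.\<close>

lemma based_in_star:
  assumes C: "convex C" "C \<subseteq> S" "u \<in> C" and g: "path_in C g"
  shows "based g = \<one>\<^bsub>pi1 S u\<^esub>"
proof -
  have ends: "pathstart g \<in> C" "pathfinish g \<in> C" using g by auto
  have straight: "tether a = linepath u a" "closed_segment u a \<subseteq> C" if "a \<in> C" for a
    using that C closed_segment_subset[of u C a] by (auto simp: tether_def)
  have "homotopic_paths S (linepath u (pathstart g) +++ (g +++ reversepath (linepath u (pathfinish g))))
      (linepath u u)"
    using C g straight(2)[OF ends(1)] straight(2)[OF ends(2)]
    by (intro homotopic_paths_in_convex[OF C(1,2)]) (auto simp: path_image_join closed_segment_commute)
  then show ?thesis
    unfolding based_def one_eq straight(1)[OF ends(1)] straight(1)[OF ends(2)]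
    by (rule pi1_class_eqI)
qed

lemma based_reverse:
  assumes "path_in S g"
  shows "based (reversepath g) = inv\<^bsub>pi1 S u\<^esub> (based g)"
proof -
  let ?x = "pathfinish g"
  have x: "?x \<in> S" using assms ends_in by blast
  have 1: "based (linepath ?x ?x) = based (linepath ?x ?x) \<otimes>\<^bsub>pi1 S u\<^esub> based (linepath ?x ?x)"
    using x by (subst based_join[symmetric])
      (auto intro!: based_cong homotopic_paths_sym[OF homotopic_paths_lid'])
  have "based (linepath ?x ?x) = \<one>\<^bsub>pi1 S u\<^esub>"
    using x 1 l_cancel_one by simp
  moreover have "based (reversepath g) \<otimes>\<^bsub>pi1 S u\<^esub> based g = based (linepath ?x ?x)"
    using assms by (subst based_join[symmetric]) (auto intro!: based_cong homotopic_paths_linv)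
  ultimately show ?thesis using assms by (intro inv_equality[symmetric]) auto
qed

abbreviation edge :: "'a \<Rightarrow> 'a \<Rightarrow> (real \<Rightarrow> 'a) set" where
  "edge a b \<equiv> based (linepath a b)"

lemma edge_reverse:
  "closed_segment a b \<subseteq> S \<Longrightarrow> edge b a = inv\<^bsub>pi1 S u\<^esub> edge a b"
  by (subst based_reverse[symmetric]) auto

text \<open>A vertex may be inserted into a polygon as long as the triangle it spans lies in a convex
region of the space.\<close>

lemma edge_triangle:
  assumes "convex C" "C \<subseteq> S" "a \<in> C" "b \<in> C" "c \<in> C"
  shows "edge a b \<otimes>\<^bsub>pi1 S u\<^esub> edge b c = edge a c"
proof -
  have seg: "closed_segment x y \<subseteq> C" if "x \<in> C" "y \<in> C" for x y
    using that assms(1) closed_segment_subset by blast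
  have segS: "closed_segment x y \<subseteq> S" if "x \<in> C" "y \<in> C" for x y
    using seg[OF that] assms(2) by blast
  have "edge a b \<otimes>\<^bsub>pi1 S u\<^esub> edge b c = based (linepath a b +++ linepath b c)"
    using assms segS by (intro based_join[symmetric]) auto
  also have "\<dots> = edge a c"
    using assms seg
    by (intro based_cong homotopic_paths_in_convex[OF assms(1,2)]) (auto simp: path_image_join)
  finally show ?thesis .
qed

fun edge_product :: "'a list \<Rightarrow> (real \<Rightarrow> 'a) set" where
  "edge_product (a # b # vs) = edge a b \<otimes>\<^bsub>pi1 S u\<^esub> edge_product (b # vs)"
| "edge_product vs = \<one>\<^bsub>pi1 S u\<^esub>"

lemma edge_product_closed [simp]:
  "edges_in S vs \<Longrightarrow> edge_product vs \<in> carrier (pi1 S u)"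
  by (induction vs rule: edge_product.induct) auto

lemma edge_product_snoc:
  assumes "edges_in S vs" "vs \<noteq> []" "closed_segment (last vs) b \<subseteq> S"
  shows "edge_product (vs @ [b]) = edge_product vs \<otimes>\<^bsub>pi1 S u\<^esub> edge (last vs) b"
  using assms
proof (induction vs rule: edge_product.induct)
  case (1 a c vs)
  then show ?case by (auto simp: m_assoc)
qed auto

end

section \<open>Circles round a point and their chords\<close>

text \<open>Polar coordinates: \<open>w \<mapsto> z + exp w\<close> maps a half-plane onto the punctured disk round \<open>z\<close>. Since the
half-plane is convex, paths round \<open>z\<close> are homotopic as soon as they lift to paths with common ends.\<close>

lemma polar_homotopic:
  fixes z :: complex
  assumes "\<rho> > 0" "path g" "path h" "pathstart g = pathstart h" "pathfinish g = pathfinish h"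
    "\<And>w. w \<in> path_image g \<union> path_image h \<Longrightarrow> Re w \<le> ln \<rho>"
  shows "homotopic_paths (cball z \<rho> - {z}) ((\<lambda>w. z + exp w) \<circ> g) ((\<lambda>w. z + exp w) \<circ> h)"
proof (rule homotopic_paths_continuous_image[where S = "{w. Re w \<le> ln \<rho>}"])
  show "homotopic_paths {w. Re w \<le> ln \<rho>} g h"
    using assms by (intro homotopic_paths_in_convex[OF convex_halfspace_Re_le]) auto
  have "exp (Re w) \<le> \<rho>" if "Re w \<le> ln \<rho>" for w
    using that assms(1) by (metis exp_le_cancel_iff exp_ln)
  then show "(\<lambda>w. z + exp w) \<in> {w. Re w \<le> ln \<rho>} \<rightarrow> cball z \<rho> - {z}"
    by (auto simp: dist_norm)
qed (intro continuous_intros)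

text \<open>A spiral round \<open>z\<close>, given by the logarithms of its two ends relative to \<open>z\<close>.\<close>

definition polar_arc :: "complex \<Rightarrow> complex \<Rightarrow> complex \<Rightarrow> real \<Rightarrow> complex" where
  "polar_arc z \<alpha> \<beta> = (\<lambda>w. z + exp w) \<circ> linepath \<alpha> \<beta>"

lemma polar_arc_simps [simp]:
  "path (polar_arc z \<alpha> \<beta>)" "pathstart (polar_arc z \<alpha> \<beta>) = z + exp \<alpha>"
  "pathfinish (polar_arc z \<alpha> \<beta>) = z + exp \<beta>"
  unfolding polar_arc_def
  by (auto simp: pathstart_compose pathfinish_compose intro!: path_continuous_image continuous_intros)

lemma Re_log_le:
  assumes "exp \<alpha> = p - z" "p \<in> cball z \<rho>"
  shows "Re \<alpha> \<le> ln \<rho>"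
proof -
  have "exp (Re \<alpha>) \<le> \<rho>"
    using assms norm_exp_eq_Re[of \<alpha>] by (simp add: dist_norm norm_minus_commute)
  then show ?thesis by (metis exp_gt_zero ln_exp ln_le_cancel_iff order_less_le_trans)
qed

text \<open>An arc that turns by less than \<open>\<pi>\<close> lies in an open half-plane bounded by a line through \<open>z\<close>, which
cuts a convex set out of the disk; the chord lies in the same set.\<close>

lemma polar_arc_homotopic_chord:
  assumes "\<rho> > 0" "\<bar>Im \<alpha> - Im \<beta>\<bar> < pi"
    and p: "exp \<alpha> = p - z" "p \<in> cball z \<rho>" and q: "exp \<beta> = q - z" "q \<in> cball z \<rho>"
  shows "homotopic_paths (cball z \<rho> - {z}) (polar_arc z \<alpha> \<beta>) (linepath p q)"
proof -
  \<comment> \<open>the direction of the bisector of the arc, normal to the bounding line\<close>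
  define m where "m = (Im \<alpha> + Im \<beta>) / 2"
  define C where "C = cball z \<rho> \<inter> {w. inner (cis m) w > inner (cis m) z}"
  have "convex C" unfolding C_def by (intro convex_Int convex_cball convex_halfspace_gt)
  have "C \<subseteq> cball z \<rho> - {z}" unfolding C_def by auto
  have arc: "z + exp w \<in> C" if w: "w \<in> closed_segment \<alpha> \<beta>" for w
  proof -
    have "Re w \<le> ln \<rho>"
      using w Re_log_le[OF p] Re_log_le[OF q]
        closed_segment_subset[OF _ _ convex_halfspace_Re_le[of "ln \<rho>"], of \<alpha> \<beta>] by auto
    then have le: "exp (Re w) \<le> \<rho>" using assms(1) by (metis exp_le_cancel_iff exp_ln)
    have "Im w \<in> closed_segment (Im \<alpha>) (Im \<beta>)"
      using w by (auto simp: closed_segment_def)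
    then have "min (Im \<alpha>) (Im \<beta>) \<le> Im w" "Im w \<le> max (Im \<alpha>) (Im \<beta>)"
      unfolding closed_segment_eq_real_ivl by (auto split: if_splits)
    moreover have "2 * m = Im \<alpha> + Im \<beta>" by (simp add: m_def)
    ultimately have m: "\<bar>Im w - m\<bar> < pi / 2"
      using assms(2) by linarith
    have "cos (Im w - m) > 0" using m by (intro cos_gt_zero_pi; linarith)
    then have "exp (Re w) * (cos (Im w) * cos m + sin (Im w) * sin m) > 0"
      by (simp add: cos_diff)
    with le show ?thesis
      by (simp add: C_def dist_norm inner_complex_def Re_exp Im_exp algebra_simps)
  qed
  have *: "z + exp \<alpha> = p" "z + exp \<beta> = q" using p q by auto
  have "p \<in> C" "q \<in> C" using arc[of \<alpha>] arc[of \<beta>] * by auto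
  have img: "path_image (polar_arc z \<alpha> \<beta>) \<subseteq> C"
    unfolding polar_arc_def path_image_compose using arc by auto
  have seg: "closed_segment p q \<subseteq> C"
    using \<open>convex C\<close> \<open>p \<in> C\<close> \<open>q \<in> C\<close> closed_segment_subset by blast
  show ?thesis
    using img seg * by (intro homotopic_paths_in_convex[OF \<open>convex C\<close> \<open>C \<subseteq> _\<close>]) auto
qed

definition circle_at :: "complex \<Rightarrow> complex \<Rightarrow> real \<Rightarrow> complex" where
  "circle_at z p = (\<lambda>s. z + (p - z) * cis (2 * pi * s))"

lemma circle_at_polar:
  assumes "exp \<alpha> = p - z"
  shows "circle_at z p = polar_arc z \<alpha> (\<alpha> + 2 * pi * \<i>)"
proof
  fix s
  have "linepath \<alpha> (\<alpha> + 2 * pi * \<i>) s = \<alpha> + \<i> * (2 * pi * s)"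
    by (simp add: linepath_def algebra_simps complex_eq_iff)
  then show "circle_at z p s = polar_arc z \<alpha> (\<alpha> + 2 * pi * \<i>) s"
    using assms by (simp add: circle_at_def polar_arc_def exp_add cis_conv_exp)
qed

lemma circle_at_simps [simp]:
  "path (circle_at z p)" "pathstart (circle_at z p) = p" "pathfinish (circle_at z p) = p"
  unfolding circle_at_def path_def pathstart_def pathfinish_def
  by (auto intro!: continuous_intros)

lemma circle_at_image:
  assumes "p \<in> cball z \<rho> - {z}" shows "path_image (circle_at z p) \<subseteq> cball z \<rho> - {z}"
  using assms by (auto simp: path_image_def circle_at_def dist_norm norm_mult norm_minus_commute)

text \<open>The lift of the circle at \<open>p\<close> is a vertical segment of length \<open>2\<pi>\<close>. It is deformed to the path that first goes to
the lift of \<open>q\<close>, then up by \<open>2\<pi>\<close>, and then back; the ways there and back lie over the same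
arc, which is a chord up to homotopy because the angle between \<open>p\<close> and \<open>q\<close>, seen from \<open>z\<close>,
is less than \<open>\<pi>\<close>.\<close>

lemma circle_at_conjugate:
  assumes "p \<in> cball z \<rho>" "q \<in> cball z \<rho>" "z \<notin> closed_segment p q"
  shows "homotopic_paths (cball z \<rho> - {z}) (circle_at z p)
    (linepath p q +++ (circle_at z q +++ linepath q p))"
proof -
  have ne: "p \<noteq> z" "q \<noteq> z" using assms(3) by auto
  have "0 < dist z p" "dist z p \<le> \<rho>" using assms(1) ne(1) by auto
  then have "\<rho> > 0" by linarith
  define \<alpha> where "\<alpha> = Ln (p - z)"
  define \<delta> where "\<delta> = Ln ((q - z) / (p - z))"
  let ?\<beta> = "\<alpha> + \<delta>" and ?t = "2 * pi * \<i>"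
  have p: "exp \<alpha> = p - z" "exp (\<alpha> + ?t) = p - z"
    using ne by (auto simp: \<alpha>_def exp_add)
  have q: "exp ?\<beta> = q - z" "exp (?\<beta> + ?t) = q - z"
    using ne p by (auto simp: \<delta>_def exp_add)
  have "(q - z) / (p - z) \<notin> \<real>\<^sub>\<le>\<^sub>0"
  proof
    assume "(q - z) / (p - z) \<in> \<real>\<^sub>\<le>\<^sub>0"
    then obtain x where x: "(q - z) / (p - z) = of_real x" "x \<le> 0"
      by (auto elim!: nonpos_Reals_cases)
    then have "q - z = of_real x * (p - z)" using ne by (simp add: field_simps)
    then have "z = (1 - 1 / (1 - x)) *\<^sub>R p + (1 / (1 - x)) *\<^sub>R q"
      using x(2) unfolding scaleR_conv_of_real
      by (simp add: field_simps of_real_diff[symmetric] del: of_real_diff) (simp add: algebra_simps)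
    then have "z \<in> closed_segment p q"
      unfolding closed_segment_def using x(2) by (auto intro!: exI[of _ "1 / (1 - x)"])
    then show False using assms(3) by simp
  qed
  moreover have "(q - z) / (p - z) \<noteq> 0" using ne by auto
  ultimately have "\<bar>Im \<delta>\<bar> < pi"
    unfolding \<delta>_def using Im_Ln_le_pi mpi_less_Im_Ln Im_Ln_eq_pi
    by (metis abs_less_iff complex_nonpos_Reals_iff minus_less_iff nless_le order_le_less)
  then have d: "\<bar>Im \<alpha> - Im ?\<beta>\<bar> < pi" "\<bar>Im (?\<beta> + ?t) - Im (\<alpha> + ?t)\<bar> < pi" by auto
  have Re: "Re \<alpha> \<le> ln \<rho>" "Re ?\<beta> \<le> ln \<rho>"
    using Re_log_le[OF p(1) assms(1)] Re_log_le[OF q(1) assms(2)] by auto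
  have le: "Re w \<le> ln \<rho>" if "w \<in> closed_segment x y" "Re x \<le> ln \<rho>" "Re y \<le> ln \<rho>" for w x y
    using closed_segment_subset[OF _ _ convex_halfspace_Re_le[of "ln \<rho>"], of x y] that by auto
  have "homotopic_paths (cball z \<rho> - {z}) ((\<lambda>w. z + exp w) \<circ> linepath \<alpha> (\<alpha> + ?t))
    ((\<lambda>w. z + exp w) \<circ> (linepath \<alpha> ?\<beta> +++ (linepath ?\<beta> (?\<beta> + ?t) +++ linepath (?\<beta> + ?t) (\<alpha> + ?t))))"
    using Re by (intro polar_homotopic[OF \<open>\<rho> > 0\<close>]) (auto simp: path_image_join elim!: le)
  then have "homotopic_paths (cball z \<rho> - {z}) (circle_at z p)
    (polar_arc z \<alpha> ?\<beta> +++ (circle_at z q +++ polar_arc z (?\<beta> + ?t) (\<alpha> + ?t)))"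
    by (simp add: path_compose_join polar_arc_def circle_at_polar[OF p(1)] circle_at_polar[OF q(1)])
  also have "homotopic_paths (cball z \<rho> - {z}) \<dots>
    (linepath p q +++ (circle_at z q +++ linepath q p))"
    using assms ne p q d circle_at_image[of q z \<rho>] \<open>\<rho> > 0\<close>
    by (intro homotopic_paths_join polar_arc_homotopic_chord) auto
  finally show ?thesis .
qed

text \<open>Divide the circle into four quarters and replace each of them by its chord.\<close>

lemma circle_at_square:
  assumes "p \<in> cball z \<rho>" "p \<noteq> z"
  defines "p1 \<equiv> z + \<i> * (p - z)" and "p2 \<equiv> z - (p - z)" and "p3 \<equiv> z - \<i> * (p - z)"
  shows "homotopic_paths (cball z \<rho> - {z}) (circle_at z p)
    (linepath p p1 +++ (linepath p1 p2 +++ (linepath p2 p3 +++ linepath p3 p)))"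
proof -
  have "0 < dist z p" "dist z p \<le> \<rho>" using assms(1,2) by auto
  then have "\<rho> > 0" by linarith
  define \<alpha> where "\<alpha> = Ln (p - z)"
  let ?h = "(pi / 2) * \<i>"
  let ?a1 = "\<alpha> + ?h" and ?a2 = "\<alpha> + ?h + ?h" and ?a3 = "\<alpha> + ?h + ?h + ?h" and ?a4 = "\<alpha> + 2 * pi * \<i>"
  have h: "exp ?h = \<i>" by (simp add: exp_eq_polar)
  have e: "exp \<alpha> = p - z" "exp ?a1 = p1 - z" "exp ?a2 = p2 - z" "exp ?a3 = p3 - z" "exp ?a4 = p - z"
    using assms(2) unfolding exp_add h by (auto simp: \<alpha>_def p1_def p2_def p3_def algebra_simps)
  have ball: "p1 \<in> cball z \<rho>" "p2 \<in> cball z \<rho>" "p3 \<in> cball z \<rho>"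
    using assms(1) unfolding p1_def p2_def p3_def
    by (auto simp: dist_norm norm_mult norm_minus_commute)
  have Re: "Re \<alpha> \<le> ln \<rho>" using Re_log_le[OF e(1) assms(1)] .
  have le: "Re w \<le> ln \<rho>" if "w \<in> closed_segment x y" "Re x \<le> ln \<rho>" "Re y \<le> ln \<rho>" for w x y
    using closed_segment_subset[OF _ _ convex_halfspace_Re_le[of "ln \<rho>"], of x y] that by auto
  have "homotopic_paths (cball z \<rho> - {z}) ((\<lambda>w. z + exp w) \<circ> linepath \<alpha> ?a4)
    ((\<lambda>w. z + exp w) \<circ> (linepath \<alpha> ?a1 +++ (linepath ?a1 ?a2 +++ (linepath ?a2 ?a3 +++ linepath ?a3 ?a4))))"
    using Re by (intro polar_homotopic[OF \<open>\<rho> > 0\<close>]) (auto simp: path_image_join elim!: le)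
  then have "homotopic_paths (cball z \<rho> - {z}) (circle_at z p)
    (polar_arc z \<alpha> ?a1 +++ (polar_arc z ?a1 ?a2 +++ (polar_arc z ?a2 ?a3 +++ polar_arc z ?a3 ?a4)))"
    by (simp add: path_compose_join polar_arc_def circle_at_polar[OF e(1)])
  also have "homotopic_paths (cball z \<rho> - {z}) \<dots>
    (linepath p p1 +++ (linepath p1 p2 +++ (linepath p2 p3 +++ linepath p3 p)))"
    using assms(1,2) e ball \<open>\<rho> > 0\<close>
    by (intro homotopic_paths_join polar_arc_homotopic_chord) auto
  finally show ?thesis .
qed

section \<open>The lasso of a polygon\<close>

lemma lasso_at_first_hit:
  assumes "t \<in> {0..1}" "pathfinish q = z" "dist (q t) z \<le> r" "\<And>s. 0 \<le> s \<Longrightarrow> s < t \<Longrightarrow> r < dist (q s) z"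
  shows "lasso q r = subpath 0 t q +++ (circle_at z (q t) +++ reversepath (subpath 0 t q))"
proof -
  have "Inf {s \<in> {0..1}. dist (q s) (pathfinish q) \<le> r} = t"
    using assms by (intro cInf_eq_minimum) (auto simp: not_less[symmetric])
  then show ?thesis by (simp add: lasso_def Let_def circle_at_def assms(2))
qed

lemma polygonal_path_Cons:
  "vs \<noteq> [] \<Longrightarrow> polygonal_path (a # b # vs) = linepath a b +++ polygonal_path (b # vs)"
  by (cases vs) auto

lemma path_polygonal_path:
  "path (polygonal_path vs) \<and> (vs \<noteq> [] \<longrightarrow>
     pathstart (polygonal_path vs) = hd vs \<and> pathfinish (polygonal_path vs) = last vs)"
proof -
  have const: "path (\<lambda>_. a)" "pathstart (\<lambda>_. a) = a" "pathfinish (\<lambda>_. a) = a" for a :: complex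
    by (simp_all add: path_def pathstart_def pathfinish_def)
  show ?thesis
    by (induction vs rule: polygonal_path.induct) (auto simp: const)
qed

lemma subpath_0_linepath: "subpath 0 t (linepath a b) = linepath a (linepath a b t)"
  by (auto simp: subpath_def linepath_def algebra_simps fun_eq_iff)

text \<open>Cutting a concatenation off in its second half: parameter \<open>\<tau>\<close> of \<open>h\<close> is parameter
\<open>(1 + \<tau>) / 2\<close> of \<open>g +++ h\<close>. The end of \<open>h\<close> may lie outside \<open>S\<close>, as it does for a path ending in a
puncture, so the reparametrization must not involve all of \<open>h\<close>.\<close>

lemma initial_part_join:
  fixes g h :: "real \<Rightarrow> 'a::real_normed_vector"
  assumes g: "path_in S g" and h: "path h" "pathfinish g = pathstart h"
    and \<tau>: "0 \<le> \<tau>" "\<tau> \<le> 1" "path_in S (subpath 0 \<tau> h)"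
  defines "t \<equiv> (1 + \<tau>) / 2"
  shows "0 \<le> t" "t \<le> 1" "(g +++ h) t = h \<tau>"
    "path_in S (subpath 0 t (g +++ h))"
    "homotopic_paths S (subpath 0 t (g +++ h)) (g +++ subpath 0 \<tau> h)"
    "0 \<le> s \<Longrightarrow> s < t \<Longrightarrow> (g +++ h) s \<in> path_image g \<union> h ` {0..<\<tau>}"
proof -
  have "2 * t = 1 + \<tau>" by (simp add: t_def)
  then have t: "0 \<le> t" "t \<le> 1" "1/2 \<le> t" "2 * t - 1 = \<tau>" using \<tau>(1,2) by linarith+
  have first: "(g +++ h) s = g (2 * s)" if "s \<le> 1/2" for s
    using that unfolding joinpaths_def by simp
  have second: "(g +++ h) s = h (2 * s - 1)" if "s \<ge> 1/2" for s
  proof (cases "s = 1/2")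
    case True
    show ?thesis unfolding True using h(2) by (simp add: joinpaths_def pathstart_def pathfinish_def)
  next
    case False
    then have "\<not> s \<le> 1/2" using that by linarith
    then show ?thesis unfolding joinpaths_def by simp
  qed
  let ?f = "subpath 0 t (g +++ h)"
  have in_g: "(g +++ h) s \<in> path_image g" if "0 \<le> s" "s \<le> 1/2" for s
    using that unfolding path_image_def first[OF that(2)] by auto
  have "(g +++ h) s \<in> S" if "0 \<le> s" "s \<le> t" for s
  proof (cases "s \<le> 1/2")
    case True
    then show ?thesis using in_g[OF that(1)] g by blast
  next
    case False
    then have "h (2 * s - 1) \<in> path_image (subpath 0 \<tau> h)"
      unfolding path_image_subpath using \<tau> t that by (auto intro!: imageI)
    then show ?thesis using False \<tau>(3) second[of s] by auto
  qed
  then have "path_image ?f \<subseteq> S" using t(1) by (auto simp: path_image_subpath)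
  moreover have "path ?f" using g h t by (auto intro!: path_subpath)
  ultimately have f: "path_in S ?f" by simp
  \<comment> \<open>the parameter of the truncated path at which \<open>g\<close> ends\<close>
  define v where "v = 1 / (2 * t)"
  have v: "t * v = 1/2" "v \<in> {0..1}" using t(3) by (auto simp: v_def field_simps)
  have f1: "subpath 0 v ?f x = g x" if "x \<in> {0..1}" for x
  proof -
    have "subpath 0 v ?f x = (g +++ h) (t * (v * x))" by (simp add: subpath_def)
    also have "t * (v * x) = (t * v) * x" by (rule mult.assoc[symmetric])
    also have "(g +++ h) \<dots> = (g +++ h) (x / 2)" unfolding v(1) by simp
    finally show ?thesis using that first[of "x / 2"] by simp
  qed
  have f2: "subpath v 1 ?f x = subpath 0 \<tau> h x" if "x \<in> {0..1}" for x
  proof -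
    have "subpath v 1 ?f x = (g +++ h) (t * ((1 - v) * x + v))" by (simp add: subpath_def)
    also have "t * ((1 - v) * x + v) = t * x - (t * v) * x + t * v" by algebra
    also have "\<dots> = 1/2 + \<tau> * x / 2" unfolding t(4)[symmetric] v(1) by algebra
    also have "(g +++ h) \<dots> = h (\<tau> * x)"
      using that \<tau>(1) second[of "1/2 + \<tau> * x / 2"] by simp
    finally show ?thesis by (simp add: subpath_def)
  qed
  have "homotopic_paths S (subpath 0 v ?f +++ subpath v 1 ?f) (subpath 0 1 ?f)"
    using f v(2) by (intro homotopic_join_subpaths) auto
  then have 1: "homotopic_paths S (subpath 0 v ?f +++ subpath v 1 ?f) ?f" by simp
  have "(g +++ subpath 0 \<tau> h) x = (subpath 0 v ?f +++ subpath v 1 ?f) x" if "x \<in> {0..1}" for x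
    using that f1[of "2 * x"] f2[of "2 * x - 1"] by (auto simp: joinpaths_def)
  moreover have "path_in S (g +++ subpath 0 \<tau> h)"
  proof -
    have "pathfinish g = pathstart (subpath 0 \<tau> h)" using h(2) by (simp add: pathstart_def subpath_def)
    then show ?thesis using g \<tau>(3) by (simp add: path_image_join)
  qed
  ultimately have "homotopic_paths S (g +++ subpath 0 \<tau> h) (subpath 0 v ?f +++ subpath v 1 ?f)"
    by (intro homotopic_paths_eq) auto
  from homotopic_paths_trans[OF this 1]
  show "homotopic_paths S ?f (g +++ subpath 0 \<tau> h)" by (rule homotopic_paths_sym)
  show "path_in S ?f" by (rule f)
  show "0 \<le> t" "t \<le> 1" "(g +++ h) t = h \<tau>" using t second[of t] by simp_all
  assume s: "0 \<le> s" "s < t"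
  show "(g +++ h) s \<in> path_image g \<union> h ` {0..<\<tau>}"
  proof (cases "s \<le> 1/2")
    case True
    then show ?thesis using in_g s by blast
  next
    case False
    then have "2 * s - 1 \<in> {0..<\<tau>}" using s t(4) by auto
    then show ?thesis using second[of s] False by auto
  qed
qed

text \<open>The point at distance \<open>r\<close> from \<open>z\<close> on the ray from \<open>z\<close> through \<open>a\<close>.\<close>

definition approach_point :: "complex \<Rightarrow> complex \<Rightarrow> real \<Rightarrow> complex" where
  "approach_point a z r = z + (r / dist a z) *\<^sub>R (a - z)"

locale planar_space = based_space S u for S :: "complex set" and u
begin

text \<open>A polygon whose edges before the last one stay farther than \<open>r\<close> from its end \<open>z\<close> meets the disk of radius \<open>r\<close>
for the first time on its last edge, so its part up to there is homotopic to the polygon with the last edge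
shortened.\<close>

lemma polygonal_path_first_hit:
  assumes "vs \<noteq> []" "edges_in S vs" "edges_in (- cball z r) vs" "r > 0"
    "closed_segment (last vs) z - {z} \<subseteq> S"
  shows "\<exists>t. 0 \<le> t \<and> t \<le> 1 \<and> polygonal_path (vs @ [z]) t = approach_point (last vs) z r \<and>
    (\<forall>s. 0 \<le> s \<longrightarrow> s < t \<longrightarrow> r < dist (polygonal_path (vs @ [z]) s) z) \<and>
    path_in S (subpath 0 t (polygonal_path (vs @ [z]))) \<and>
    closed_segment (last vs) (approach_point (last vs) z r) \<subseteq> S \<and>
    based (subpath 0 t (polygonal_path (vs @ [z]))) =
      edge_product vs \<otimes>\<^bsub>pi1 S u\<^esub> edge (last vs) (approach_point (last vs) z r)"
  using assms
proof (induction vs rule: induct_list012)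
  case (2 a)
  then have far: "r < dist a z" by (simp add: dist_commute)
  then have pos: "0 < dist a z" using \<open>r > 0\<close> by linarith
  define t where "t = 1 - r / dist a z"
  define p where "p = approach_point a z r"
  have t: "t \<in> {0..1}" using far pos \<open>r > 0\<close> by (auto simp: t_def field_simps)
  have p: "linepath a z t = p"
    by (simp add: t_def p_def approach_point_def linepath_def algebra_simps)
  have dist: "dist (linepath a z s) z = (1 - s) * dist a z" if "s \<le> 1" for s
  proof -
    have "linepath a z s - z = (1 - s) *\<^sub>R (a - z)" by (simp add: linepath_def algebra_simps)
    then show ?thesis using that by (simp add: dist_norm)
  qed
  have hit: "r < dist (linepath a z s) z" if "0 \<le> s" "s < t" for s
  proof -
    have "s \<le> 1" using that t by auto
    moreover have "r / dist a z < 1 - s" using that by (simp add: t_def)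
    ultimately show ?thesis using pos by (simp add: dist pos_divide_less_eq)
  qed
  have "p \<noteq> z" using pos \<open>r > 0\<close> by (auto simp: p_def approach_point_def)
  have "p \<in> closed_segment a z"
    using t linepath_in_path[of t a z] p by simp
  then have "closed_segment a p \<subseteq> closed_segment a z" by (simp add: subset_closed_segment)
  moreover have "z \<notin> closed_segment a p"
  proof
    assume "z \<in> closed_segment a p"
    then have "dist a z \<le> dist a p" using dist_in_closed_segment[of z a p] by (simp add: dist_commute)
    moreover have "dist a p = t * dist a z"
    proof -
      have "a - p = t *\<^sub>R (a - z)" by (simp add: t_def p_def approach_point_def algebra_simps)
      then show ?thesis using t by (simp add: dist_norm)
    qed
    moreover have "t < 1" using pos \<open>r > 0\<close> by (simp add: t_def)
    ultimately show False using pos by auto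
  qed
  ultimately have seg: "closed_segment a p \<subseteq> S" using 2 by auto
  show ?case
  proof (intro exI[of _ t] conjI)
    show "polygonal_path ([a] @ [z]) t = approach_point (last [a]) z r"
      using p by (simp add: p_def)
    show "\<forall>s. 0 \<le> s \<longrightarrow> s < t \<longrightarrow> r < dist (polygonal_path ([a] @ [z]) s) z"
      using hit by simp
    have "subpath 0 t (polygonal_path ([a] @ [z])) = linepath a p"
      using p by (simp add: subpath_0_linepath)
    then show "path (subpath 0 t (polygonal_path ([a] @ [z])))"
      "path_image (subpath 0 t (polygonal_path ([a] @ [z]))) \<subseteq> S"
      "closed_segment (last [a]) (approach_point (last [a]) z r) \<subseteq> S"
      "based (subpath 0 t (polygonal_path ([a] @ [z]))) =
        edge_product [a] \<otimes>\<^bsub>pi1 S u\<^esub> edge (last [a]) (approach_point (last [a]) z r)"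
      using seg by (simp_all add: p_def[symmetric])
  qed (use t in auto)
next
  case (3 a b vs)
  let ?g = "linepath a b" and ?q2 = "polygonal_path ((b # vs) @ [z])"
  define a' where "a' = last (b # vs)"
  define p where "p = approach_point a' z r"
  have pre: "edges_in S (b # vs)" "edges_in (- cball z r) (b # vs)"
    "closed_segment (last (b # vs)) z - {z} \<subseteq> S" using "3.prems" by auto
  obtain t2 where t2: "0 \<le> t2" "t2 \<le> 1" "?q2 t2 = p"
    and far: "\<And>s. 0 \<le> s \<Longrightarrow> s < t2 \<Longrightarrow> r < dist (?q2 s) z"
    and q2: "path_in S (subpath 0 t2 ?q2)" "closed_segment a' p \<subseteq> S"
      "based (subpath 0 t2 ?q2) = edge_product (b # vs) \<otimes>\<^bsub>pi1 S u\<^esub> edge a' p"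
    using "3.IH"(2)[OF _ pre(1,2) \<open>r > 0\<close> pre(3)] unfolding p_def a'_def by blast
  define t where "t = (1 + t2) / 2"
  have q: "polygonal_path ((a # b # vs) @ [z]) = ?g +++ ?q2"
    by (simp add: polygonal_path_Cons)
  have pq2: "path ?q2" "pathstart ?q2 = b"
    using path_polygonal_path[of "(b # vs) @ [z]"] by auto
  have gS: "path_in S ?g" "closed_segment a b \<subseteq> - cball z r" "edges_in S (b # vs)" using "3.prems" by auto
  have *: "pathfinish ?g = pathstart ?q2" "0 \<le> t2" "t2 \<le> 1" using pq2 t2(1,2) by auto
  note join = initial_part_join[OF gS(1) pq2(1) * q2(1), folded t_def]
  have "based (subpath 0 t (?g +++ ?q2)) = based (?g +++ subpath 0 t2 ?q2)"
    using join(5) by (rule based_cong)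
  also have "\<dots> = edge a b \<otimes>\<^bsub>pi1 S u\<^esub> (edge_product (b # vs) \<otimes>\<^bsub>pi1 S u\<^esub> edge a' p)"
  proof -
    have "pathfinish ?g = pathstart (subpath 0 t2 ?q2)" using pq2(2) by (simp add: pathstart_def subpath_def)
    then show ?thesis using gS(1) q2 by (simp add: based_join)
  qed
  also have "\<dots> = edge_product (a # b # vs) \<otimes>\<^bsub>pi1 S u\<^esub> edge a' p"
    using gS q2(2) by (simp add: m_assoc)
  finally have b: "based (subpath 0 t (?g +++ ?q2)) = edge_product (a # b # vs) \<otimes>\<^bsub>pi1 S u\<^esub> edge a' p" .
  have hit: "r < dist ((?g +++ ?q2) s) z" if "0 \<le> s" "s < t" for s
    using join(6)[OF that]
  proof
    assume "(?g +++ ?q2) s \<in> path_image ?g"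
    then have "(?g +++ ?q2) s \<in> - cball z r" using gS(2) by auto
    then show ?thesis by (simp add: dist_commute)
  next
    assume "(?g +++ ?q2) s \<in> ?q2 ` {0..<t2}"
    then show ?thesis using far by force
  qed
  have l: "last (a # b # vs) = a'" by (simp add: a'_def)
  show ?case unfolding q l p_def[symmetric]
  proof (intro exI[of _ t] conjI allI impI)
    show "(?g +++ ?q2) t = p" using join(3) t2(3) by simp
    show "based (subpath 0 t (?g +++ ?q2)) = edge_product (a # b # vs) \<otimes>\<^bsub>pi1 S u\<^esub> edge a' p"
      by (rule b)
    show "0 \<le> t" by (rule join(1))
    show "t \<le> 1" by (rule join(2))
    show "r < dist ((?g +++ ?q2) s) z" if "0 \<le> s" "s < t" for s by (rule hit[OF that])
    show "path (subpath 0 t (?g +++ ?q2))" by (rule join(4)[THEN conjunct1])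
    show "path_image (subpath 0 t (?g +++ ?q2)) \<subseteq> S" by (rule join(4)[THEN conjunct2])
    show "closed_segment a' p \<subseteq> S" by (rule q2(2))
  qed
qed simp

text \<open>For small \<open>r\<close> the lasso follows the polygon up to the point \<open>p\<close> where its last edge meets the
circle of radius \<open>r\<close>, runs round that circle, and returns. By \<open>circle_at_conjugate\<close> the circle may
be replaced by the one through \<open>d\<close> at the cost of the edge from \<open>p\<close> to \<open>d\<close>, and this edge combines with the
shortened last edge to a single one inside \<open>C\<close>. The convex set \<open>C\<close> contains no
puncture, which keeps \<open>z\<close> off the segment from \<open>p\<close> to \<open>d\<close>. The resulting class does not involve \<open>r\<close>, so it
is \<open>lasso_class\<close>.\<close>

lemma lasso_class_polygonal_path:
  assumes vs: "vs \<noteq> []" "edges_in S vs" "hd vs = u"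
    and z: "z \<notin> S" "\<rho> > 0" "cball z \<rho> - {z} \<subseteq> S"
    and C: "convex C" "C \<subseteq> S" "last vs \<in> C" "d \<in> C" "closed_segment (last vs) z - {z} \<subseteq> C"
    and d: "d \<in> cball z \<rho>"
  defines "X \<equiv> edge_product (vs @ [d])"
  shows "lasso_class S (polygonal_path (vs @ [z])) =
    X \<otimes>\<^bsub>pi1 S u\<^esub> (based (circle_at z d) \<otimes>\<^bsub>pi1 S u\<^esub> inv\<^bsub>pi1 S u\<^esub> X)"
proof -
  let ?q = "polygonal_path (vs @ [z])" and ?R = "X \<otimes>\<^bsub>pi1 S u\<^esub> (based (circle_at z d) \<otimes>\<^bsub>pi1 S u\<^esub> inv\<^bsub>pi1 S u\<^esub> X)"
  define a where "a = last vs"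
  have in_C: "closed_segment x y \<subseteq> C" if "x \<in> C" "y \<in> C" for x y
    using that C(1) closed_segment_subset by blast
  have cls: "pi1_class S (lasso ?q r) = ?R"
    if r: "0 < r" "r \<le> \<rho>" "edges_in (- cball z r) vs" for r
  proof -
    define p where "p = approach_point a z r"
    have "closed_segment (last vs) z - {z} \<subseteq> S" using C by blast
    from polygonal_path_first_hit[OF vs(1,2) r(3,1) this]
    obtain t where t: "0 \<le> t" "t \<le> 1" "?q t = p" "\<And>s. 0 \<le> s \<Longrightarrow> s < t \<Longrightarrow> r < dist (?q s) z"
      and h: "path_in S (subpath 0 t ?q)" "closed_segment a p \<subseteq> S"
        "based (subpath 0 t ?q) = edge_product vs \<otimes>\<^bsub>pi1 S u\<^esub> edge a p"
      unfolding p_def a_def by blast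
    let ?h = "subpath 0 t ?q"
    have "a \<noteq> z" using C(2,3) z(1) by (auto simp: a_def)
    then have dp: "dist p z = r" using r(1) by (simp add: p_def approach_point_def dist_norm)
    have q0: "?q 0 = u" and q1: "pathfinish ?q = z" and pq: "path ?q"
      using path_polygonal_path[of "vs @ [z]"] vs by (auto simp: pathstart_def)
    have ends: "pathstart ?h = u" "pathfinish ?h = p" using q0 t by auto
    have lasso: "lasso ?q r = ?h +++ (circle_at z p +++ reversepath ?h)"
      using lasso_at_first_hit[of t ?q z r] q1 t dp by simp
    have pb: "p \<in> cball z \<rho>" "p \<noteq> z" using dp r(1,2) by (auto simp: dist_commute)
    have circS: "path_in S (circle_at z x)" if "x \<in> cball z \<rho>" "x \<noteq> z" for x
      using circle_at_image[of x z \<rho>] that z(3) by auto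
    have "r < dist a z"
      using edges_in_last[OF r(3) vs(1)] by (auto simp: a_def dist_commute)
    then have "p \<in> closed_segment a z"
      unfolding closed_segment_def p_def approach_point_def using r(1)
      by (auto intro!: exI[of _ "1 - r / dist a z"] simp: algebra_simps divide_le_eq_1)
    then have pC: "p \<in> C" using C(5) pb by (auto simp: a_def)
    have "d \<noteq> z" using C(2,4) z(1) by auto
    have zpd: "z \<notin> closed_segment p d" using in_C[OF pC C(4)] C(2) z(1) by blast
    have seg: "closed_segment p d \<subseteq> S" "closed_segment d p \<subseteq> S" "closed_segment a d \<subseteq> S"
      using in_C[OF pC C(4)] in_C[OF C(4) pC] in_C[OF C(3,4)] C(2) by (auto simp: a_def)
    have circ: "based (circle_at z p) =
        edge p d \<otimes>\<^bsub>pi1 S u\<^esub> (based (circle_at z d) \<otimes>\<^bsub>pi1 S u\<^esub> inv\<^bsub>pi1 S u\<^esub> edge p d)"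
    proof -
      have "homotopic_paths S (circle_at z p) (linepath p d +++ (circle_at z d +++ linepath d p))"
        using circle_at_conjugate[OF pb(1) d zpd] z(3) homotopic_paths_subset by blast
      then have "based (circle_at z p) = based (linepath p d +++ (circle_at z d +++ linepath d p))"
        by (rule based_cong)
      then show ?thesis
        using circS[OF d \<open>d \<noteq> z\<close>] seg edge_reverse[OF seg(1)]
        by (simp add: based_join path_image_join)
    qed
    have X: "X = based ?h \<otimes>\<^bsub>pi1 S u\<^esub> edge p d"
    proof -
      have "edge a p \<otimes>\<^bsub>pi1 S u\<^esub> edge p d = edge a d"
        using C pC by (intro edge_triangle[of C]) (auto simp: a_def)
      then show ?thesis
        using h seg vs unfolding X_def by (subst edge_product_snoc) (auto simp: a_def m_assoc)
    qed
    have hS: "path_in S (lasso ?q r)" "pathstart (lasso ?q r) = u" "pathfinish (lasso ?q r) = u"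
      unfolding lasso using h(1) ends circS[OF pb] by (auto simp: path_image_join)
    have "pi1_class S (lasso ?q r) = based (lasso ?q r)"
      using based_loop[OF hS] ..
    also have "\<dots> = based ?h \<otimes>\<^bsub>pi1 S u\<^esub> (based (circle_at z p) \<otimes>\<^bsub>pi1 S u\<^esub> inv\<^bsub>pi1 S u\<^esub> based ?h)"
      unfolding lasso using h(1) ends circS[OF pb]
      by (simp add: based_join based_reverse path_image_join)
    also have "\<dots> = ?R"
      unfolding X circ using h(1) seg circS[OF d \<open>d \<noteq> z\<close>]
      by (simp add: m_assoc inv_mult_group)
    finally show ?thesis .
  qed
  have "\<forall>\<^sub>F r in at_right 0. edges_in (- cball z r) vs"
    using edges_in_mono[OF vs(2)] z(1) by (intro eventually_edges_avoid) auto
  moreover have "\<forall>\<^sub>F r in at_right 0. 0 < r \<and> r \<le> \<rho>"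
    using z(2) unfolding eventually_at_right_field by (intro exI[of _ \<rho>]) auto
  ultimately have ev: "\<forall>\<^sub>F r in at_right 0. pi1_class S (lasso ?q r) = ?R"
    by eventually_elim (use cls in auto)
  have "(\<forall>\<^sub>F r in at_right 0. g \<in> pi1_class S (lasso ?q r)) \<longleftrightarrow> g \<in> ?R" for g
  proof -
    have "(\<forall>\<^sub>F r in at_right 0. g \<in> pi1_class S (lasso ?q r)) \<longleftrightarrow> (\<forall>\<^sub>F r in at_right (0::real). g \<in> ?R)"
      by (rule eventually_cong[OF ev]) auto
    then show ?thesis by simp
  qed
  then show ?thesis unfolding lasso_class_def by auto
qed

end

section \<open>Convex regions of the punctured disk\<close>

text \<open>An open half-plane bounded by a vertical line, together with the upper or lower open half of
that line, according to the sign of \<open>e\<close>. The factor \<open>\<sigma> = \<plusminus>1\<close> selects the side.\<close>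

definition lex_halfplane :: "real \<Rightarrow> real \<Rightarrow> real \<Rightarrow> complex set" where
  "lex_halfplane \<sigma> a e = {w. a < \<sigma> * Re w \<or> (a = \<sigma> * Re w \<and> 0 < e * Im w)}"

lemma convex_lex_halfplane: "convex (lex_halfplane \<sigma> a e)"
proof (rule convexI)
  fix x y :: complex and p q :: real
  assume xy: "x \<in> lex_halfplane \<sigma> a e" "y \<in> lex_halfplane \<sigma> a e" and pq: "0 \<le> p" "0 \<le> q" "p + q = 1"
  let ?w = "p *\<^sub>R x + q *\<^sub>R y"
  have le: "0 \<le> \<sigma> * Re x - a" "0 \<le> \<sigma> * Re y - a"
    and strict: "\<sigma> * Re x - a = 0 \<Longrightarrow> 0 < e * Im x" "\<sigma> * Re y - a = 0 \<Longrightarrow> 0 < e * Im y"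
    using xy by (auto simp: lex_halfplane_def)
  have re: "\<sigma> * Re ?w - a = p * (\<sigma> * Re x - a) + q * (\<sigma> * Re y - a)"
  proof -
    have "a = p * a + q * a" using pq(3) by (metis distrib_right mult_1)
    then show ?thesis by (simp add: algebra_simps)
  qed
  have im: "e * Im ?w = p * (e * Im x) + q * (e * Im y)" by (simp add: algebra_simps)
  show "?w \<in> lex_halfplane \<sigma> a e"
  proof (cases "\<sigma> * Re ?w - a > 0")
    case False
    have nn: "0 \<le> p * (\<sigma> * Re x - a)" "0 \<le> q * (\<sigma> * Re y - a)" using le pq by auto
    then have z: "p * (\<sigma> * Re x - a) = 0" "q * (\<sigma> * Re y - a) = 0" using False re by linarith+
    then have "p = 0 \<or> 0 < e * Im x" "q = 0 \<or> 0 < e * Im y" using strict by auto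
    then have "p = 0 \<or> 0 < p * (e * Im x)" "q = 0 \<or> 0 < q * (e * Im y)"
      using pq by (auto intro: mult_pos_pos)
    moreover have "p \<noteq> 0 \<or> q \<noteq> 0" using pq by auto
    ultimately have "0 < e * Im ?w" unfolding im by auto
    then show ?thesis using z re by (auto simp: lex_halfplane_def)
  qed (simp add: lex_halfplane_def)
qed

text \<open>The bounds on \<open>\<epsilon>\<close> keep the disks of radius \<open>\<epsilon>\<close> round the punctures inside the unit disk and
disjoint from each other.\<close>

locale marked_disk =
  fixes n :: nat and k :: "int \<Rightarrow> real" and \<epsilon> :: real
  assumes config: "puncture_config n k"
    and eps_pos: "0 < \<epsilon>"
    and eps_boundary: "i \<in> {1..int n} \<Longrightarrow> \<bar>k i\<bar> + \<epsilon> \<le> 1"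
    and eps_gap: "i \<in> {1..int n} \<Longrightarrow> i + 1 \<in> {1..int n} \<Longrightarrow> k i + 2 * \<epsilon> < k (i + 1)"

lemma path_connected_punctured_disk: "path_connected (punctured_disk n k)"
proof -
  have "aff_dim disk = 2" unfolding disk_def by (simp add: aff_dim_cball)
  then have "\<not> collinear disk" by (simp add: collinear_aff_dim)
  then show ?thesis
    by (intro path_connected_convex_diff_countable) (auto simp: disk_def punctures_def)
qed

lemma base_pt_in_punctured_disk: "base_pt \<in> punctured_disk n k"
  by (auto simp: disk_def base_pt_def punctures_def dist_norm cmod_def)

sublocale marked_disk \<subseteq> planar_space "punctured_disk n k" base_pt
  by unfold_locales (rule path_connected_punctured_disk base_pt_in_punctured_disk)+

context marked_disk begin

abbreviation mult_pi1 (infixl "\<cdot>" 70) where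
  "A \<cdot> B \<equiv> A \<otimes>\<^bsub>pi1 (punctured_disk n k) base_pt\<^esub> B"
abbreviation one_pi1 ("\<e>") where "\<e> \<equiv> \<one>\<^bsub>pi1 (punctured_disk n k) base_pt\<^esub>"

text \<open>\<open>pos i e\<close> is where the link \<open>(i,e)\<close> is drawn; \<open>side i 1\<close> and \<open>side i (-1)\<close> lie to the right and to
the left of the \<open>i\<close>-th puncture.\<close>

abbreviation centre :: "int \<Rightarrow> complex" where "centre i \<equiv> Complex (k i) 0"
abbreviation pos :: "int \<Rightarrow> int \<Rightarrow> complex" where
  "pos i e \<equiv> Complex (k i) (real_of_int e * \<epsilon>)"
abbreviation side :: "int \<Rightarrow> int \<Rightarrow> complex" where
  "side i s \<equiv> Complex (k i + real_of_int s * \<epsilon>) 0"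

lemma k_less_iff: "i \<in> {1..int n} \<Longrightarrow> j \<in> {1..int n} \<Longrightarrow> k i < k j \<longleftrightarrow> i < j"
  using config strict_mono_on_less[of "{1..int n}" k i j] by (simp add: puncture_config_def)

lemma gap:
  assumes "i \<in> {1..int n}" "j \<in> {1..int n}" "i < j" shows "k i + 2 * \<epsilon> < k j"
proof -
  have "i + 1 \<in> {1..int n}" using assms by auto
  moreover from this have "k (i + 1) \<le> k j" using k_less_iff[of j "i + 1"] assms by auto
  ultimately show ?thesis using eps_gap[of i] assms by linarith
qed

lemma ball_in:
  assumes i: "i \<in> {1..int n}"
  shows "cball (centre i) \<epsilon> - {centre i} \<subseteq> punctured_disk n k"
proof
  fix w assume w: "w \<in> cball (centre i) \<epsilon> - {centre i}"
  then have d: "norm (w - centre i) \<le> \<epsilon>" by (simp add: dist_norm norm_minus_commute)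
  have "norm w \<le> norm (w - centre i) + norm (centre i)" by (metis diff_add_cancel norm_triangle_ineq)
  also have "norm (centre i) = \<bar>k i\<bar>" by (simp add: cmod_def)
  finally have "w \<in> disk" using d eps_boundary[OF i] by (simp add: disk_def)
  moreover
  have "w \<noteq> centre j" if j: "j \<in> {1..int n}" for j
  proof (cases "j = i")
    case False
    have "\<bar>k j - k i\<bar> > 2 * \<epsilon>"
      using gap[OF i j] gap[OF j i] False by linarith
    moreover have "norm (centre j - centre i) = \<bar>k j - k i\<bar>" by (simp add: cmod_def)
    ultimately show ?thesis using d eps_pos by force
  qed (use w in auto)
  then have "w \<notin> punctures n k" unfolding punctures_def by blast
  ultimately show "w \<in> punctured_disk n k" by blast
qed

lemma near_centre:
  assumes "\<bar>s\<bar> = 1"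
  shows "pos i s \<in> cball (centre i) \<epsilon> - {centre i}" "side i s \<in> cball (centre i) \<epsilon> - {centre i}"
proof -
  have "s = 1 \<or> s = -1" using assms by linarith
  then show "pos i s \<in> cball (centre i) \<epsilon> - {centre i}" "side i s \<in> cball (centre i) \<epsilon> - {centre i}"
    using eps_pos by (auto simp: dist_norm cmod_def)
qed

lemma near_in:
  assumes "i \<in> {1..int n}" "\<bar>s\<bar> = 1"
  shows "pos i s \<in> punctured_disk n k" "side i s \<in> punctured_disk n k"
  using near_centre[OF assms(2)] ball_in[OF assms(1)] by blast+

lemma centre_not_in: "i \<in> {1..int n} \<Longrightarrow> centre i \<notin> punctured_disk n k"
  by (auto simp: punctures_def)

text \<open>The open lower half of the disk together with one segment, which may run along a piece of the axis
without punctures.\<close>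

definition lower_region :: "complex \<Rightarrow> complex \<Rightarrow> complex set" where
  "lower_region x y = disk \<inter> ({w. Im w < 0} \<union> closed_segment x y)"

lemma lower_region:
  assumes x: "x \<in> disk" "Im x \<le> 0" and y: "y \<in> disk" "Im y \<le> 0"
    and xy: "closed_segment x y \<inter> punctures n k = {}"
  shows "convex (lower_region x y)" "lower_region x y \<subseteq> punctured_disk n k"
    "base_pt \<in> lower_region x y" "x \<in> lower_region x y" "y \<in> lower_region x y"
proof -
  have disk: "convex disk" by (simp add: disk_def)
  have le: "Im w \<le> 0" if "w \<in> closed_segment x y" for w
    using closed_segment_subset[OF _ _ convex_halfspace_Im_le[of 0], of x y] x y that by auto
  show "convex (lower_region x y)"
  proof (rule convexI)
    fix v w :: complex and p q :: real
    assume vw: "v \<in> lower_region x y" "w \<in> lower_region x y" and pq: "0 \<le> p" "0 \<le> q" "p + q = 1"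
    let ?m = "p *\<^sub>R v + q *\<^sub>R w"
    have "?m \<in> disk" using vw pq disk unfolding lower_region_def convex_def by blast
    moreover have "Im ?m < 0 \<or> ?m \<in> closed_segment x y"
    proof (cases "v \<in> closed_segment x y \<and> w \<in> closed_segment x y")
      case True
      then show ?thesis using pq convex_closed_segment[of x y] unfolding convex_def by blast
    next
      case False
      have im: "Im v \<le> 0" "Im w \<le> 0" using vw le by (auto simp: lower_region_def)
      then have "p * Im v \<le> 0" "q * Im w \<le> 0" using pq by (auto simp: mult_nonneg_nonpos)
      moreover have "Im v < 0 \<or> Im w < 0" using False vw by (auto simp: lower_region_def)
      ultimately consider "p * Im v + q * Im w < 0" | "p = 0" "q = 1" | "q = 0" "p = 1"
        using pq by (metis add_neg_nonpos add_nonpos_neg add.right_neutral add.left_neutral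
          less_eq_real_def mult_pos_neg)
      then show ?thesis using vw by cases (auto simp: lower_region_def)
    qed
    ultimately show "?m \<in> lower_region x y" by (simp add: lower_region_def)
  qed
  have "w \<notin> punctures n k" if "Im w < 0" for w using that by (auto simp: punctures_def)
  then show "lower_region x y \<subseteq> punctured_disk n k" using xy by (auto simp: lower_region_def)
  show "base_pt \<in> lower_region x y"
    by (simp add: lower_region_def disk_def base_pt_def dist_norm cmod_def)
qed (use x y in \<open>auto simp: lower_region_def\<close>)

lemma lower_edge:
  assumes "x \<in> disk" "Im x \<le> 0" "y \<in> disk" "Im y \<le> 0" "closed_segment x y \<inter> punctures n k = {}"
  shows "closed_segment x y \<subseteq> punctured_disk n k" "edge x y = \<e>"
proof -
  note R = lower_region[OF assms]
  have sub: "closed_segment x y \<subseteq> lower_region x y"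
    using R(1,4,5) closed_segment_subset by blast
  then show "closed_segment x y \<subseteq> punctured_disk n k" using R(2) by blast
  show "edge x y = \<e>" using sub by (intro based_in_star[OF R(1-3)]) auto
qed

text \<open>Seen from the base point, only the end of the segment can lie on the axis.\<close>

lemma base_edge:
  assumes "x \<in> punctured_disk n k" "Im x \<le> 0"
  shows "closed_segment base_pt x \<subseteq> punctured_disk n k" "edge base_pt x = \<e>"
proof -
  have "w \<notin> punctures n k" if w: "w \<in> closed_segment base_pt x" "w \<noteq> x" for w
  proof -
    obtain t where t: "0 \<le> t" "t \<le> 1" "w = (1 - t) *\<^sub>R base_pt + t *\<^sub>R x"
      using w(1) by (auto simp: in_segment)
    then have "t \<noteq> 1" using w(2) by auto
    then have "t < 1" using t by simp
    moreover have "t * Im x \<le> 0" using t assms(2) by (simp add: mult_nonneg_nonpos)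
    ultimately have "Im w < 0" using t(3) by (simp add: base_pt_def)
    then show ?thesis by (auto simp: punctures_def)
  qed
  then have "closed_segment base_pt x \<inter> punctures n k = {}" using assms(1) by blast
  moreover have "base_pt \<in> disk" "Im base_pt \<le> 0" using base_in by (auto simp: base_pt_def)
  ultimately show "closed_segment base_pt x \<subseteq> punctured_disk n k" "edge base_pt x = \<e>"
    using lower_edge[of base_pt x] assms by auto
qed

lemma edge_side_pos:
  assumes i: "i \<in> {1..int n}" and s: "\<bar>s\<bar> = 1" "\<bar>e\<bar> = 1"
  shows "closed_segment (side i s) (pos i e) \<subseteq> punctured_disk n k"
    "closed_segment (pos i e) (side i s) \<subseteq> punctured_disk n k"
    "e = -1 \<Longrightarrow> edge (side i s) (pos i e) = \<e>"
    "e = -1 \<Longrightarrow> edge (pos i e) (side i s) = \<e>"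
proof -
  have "closed_segment (side i s) (pos i e) \<subseteq> cball (centre i) \<epsilon>"
    using near_centre[OF s(1), of i] near_centre[OF s(2), of i] by (intro closed_segment_subset) auto
  moreover have "centre i \<notin> closed_segment (side i s) (pos i e)"
  proof
    assume "centre i \<in> closed_segment (side i s) (pos i e)"
    then obtain t where "centre i = (1 - t) *\<^sub>R side i s + t *\<^sub>R pos i e"
      by (auto simp: closed_segment_def)
    then have "k i = k i + (1 - t) * (real_of_int s * \<epsilon>)" "0 = t * (real_of_int e * \<epsilon>)"
      by (auto simp: complex_eq_iff algebra_simps)
    moreover have "s \<noteq> 0" "e \<noteq> 0" using s by auto
    ultimately show False using eps_pos by auto
  qed
  ultimately show seg: "closed_segment (side i s) (pos i e) \<subseteq> punctured_disk n k"
    using ball_in[OF i] by blast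
  then show seg': "closed_segment (pos i e) (side i s) \<subseteq> punctured_disk n k"
    by (simp add: closed_segment_commute)
  assume e: "e = -1"
  have "Im (pos i e) \<le> 0" using e eps_pos by simp
  then show "edge (side i s) (pos i e) = \<e>" "edge (pos i e) (side i s) = \<e>"
    using seg seg' near_in[OF i s(1)] near_in[OF i s(2)] by (intro lower_edge; auto)+
qed

text \<open>The open vertical strip between the neighbours \<open>i\<close> and \<open>i + \<sigma>\<close>, together with the halves above
or below the axis of its two bounding lines on which \<open>pos i e\<close> and \<open>pos (i + \<sigma>) e'\<close> lie.\<close>

definition strip :: "int \<Rightarrow> int \<Rightarrow> int \<Rightarrow> int \<Rightarrow> complex set" where
  "strip i \<sigma> e e' = disk \<inter> lex_halfplane \<sigma> (\<sigma> * k i) e \<inter> lex_halfplane (- \<sigma>) (- \<sigma> * k (i + \<sigma>)) e'"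

lemma strip:
  assumes i: "i \<in> {1..int n}" and \<sigma>: "\<bar>\<sigma>\<bar> = 1" "i + \<sigma> \<in> {1..int n}"
    and e: "\<bar>e\<bar> = 1" "\<bar>e'\<bar> = 1"
  shows "convex (strip i \<sigma> e e')" "strip i \<sigma> e e' \<subseteq> punctured_disk n k"
    "pos i e \<in> strip i \<sigma> e e'" "pos (i + \<sigma>) e' \<in> strip i \<sigma> e e'"
    "side i \<sigma> \<in> strip i \<sigma> e e'" "side (i + \<sigma>) (- \<sigma>) \<in> strip i \<sigma> e e'"
proof -
  have sgn: "\<sigma> = 1 \<or> \<sigma> = -1" using \<sigma>(1) by linarith
  have sep: "\<sigma> * k i + 2 * \<epsilon> < \<sigma> * k (i + \<sigma>)"
    using sgn gap[OF i \<sigma>(2)] gap[OF \<sigma>(2) i] by auto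
  show "convex (strip i \<sigma> e e')"
    unfolding strip_def by (intro convex_Int convex_lex_halfplane) (simp add: disk_def)
  show "strip i \<sigma> e e' \<subseteq> punctured_disk n k"
  proof
    fix w assume w: "w \<in> strip i \<sigma> e e'"
    have "w \<noteq> centre l" if l: "l \<in> {1..int n}" for l
    proof
      assume "w = centre l"
      then have l': "\<sigma> * k i < \<sigma> * k l" "\<sigma> * k l < \<sigma> * k (i + \<sigma>)"
        using w by (auto simp: strip_def lex_halfplane_def)
      have less: "\<sigma> * x < \<sigma> * y \<longleftrightarrow> (if \<sigma> = 1 then x < y else y < x)" for x y :: real
        using sgn by auto
      have "if \<sigma> = 1 then i < l \<and> l < i + \<sigma> else l < i \<and> i + \<sigma> < l"
        using l'[unfolded less] k_less_iff[OF i l] k_less_iff[OF l i] k_less_iff[OF l \<sigma>(2)]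
          k_less_iff[OF \<sigma>(2) l] by presburger
      then show False using sgn by presburger
    qed
    then have "w \<notin> punctures n k" unfolding punctures_def by blast
    then show "w \<in> punctured_disk n k" using w by (auto simp: strip_def)
  qed
  have ss: "\<bar>- \<sigma>\<bar> = 1" using \<sigma> by simp
  have "real_of_int c * (real_of_int c * \<epsilon>) = \<epsilon>" if "\<bar>c\<bar> = 1" for c
  proof -
    have "c = 1 \<or> c = -1" using that by linarith
    then show ?thesis by auto
  qed
  note ee = this[OF e(1)] this[OF e(2)] this[OF \<sigma>(1)]
  show "pos i e \<in> strip i \<sigma> e e'" "pos (i + \<sigma>) e' \<in> strip i \<sigma> e e'"
    "side i \<sigma> \<in> strip i \<sigma> e e'" "side (i + \<sigma>) (- \<sigma>) \<in> strip i \<sigma> e e'"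
    unfolding strip_def lex_halfplane_def
    using near_in[OF i \<sigma>(1)] near_in[OF i e(1)] near_in[OF \<sigma>(2) ss] near_in[OF \<sigma>(2) e(2)] sep eps_pos
    by (simp_all add: distrib_left right_diff_distrib ee)
qed

text \<open>Inside the strip, the edge may be deformed to one that comes down to the axis next to \<open>i\<close>, runs along the axis, and
leaves it next to \<open>i + \<sigma>\<close>; the middle part has trivial value.\<close>

lemma edge_between_neighbours:
  assumes i: "i \<in> {1..int n}" and \<sigma>: "\<bar>\<sigma>\<bar> = 1" "i + \<sigma> \<in> {1..int n}"
    and e: "\<bar>e\<bar> = 1" "\<bar>e'\<bar> = 1"
  shows "closed_segment (pos i e) (pos (i + \<sigma>) e') \<subseteq> punctured_disk n k"
    "edge (pos i e) (pos (i + \<sigma>) e') =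
      edge (pos i e) (side i \<sigma>) \<cdot> edge (side (i + \<sigma>) (- \<sigma>)) (pos (i + \<sigma>) e')"
proof -
  note R = strip[OF assms]
  have sub: "closed_segment x y \<subseteq> strip i \<sigma> e e'" if "x \<in> strip i \<sigma> e e'" "y \<in> strip i \<sigma> e e'" for x y
    using that R(1) closed_segment_subset by blast
  show "closed_segment (pos i e) (pos (i + \<sigma>) e') \<subseteq> punctured_disk n k"
    using sub[OF R(3,4)] R(2) by blast
  have ss: "\<bar>- \<sigma>\<bar> = 1" using \<sigma> by simp
  let ?a = "side i \<sigma>" and ?b = "side (i + \<sigma>) (- \<sigma>)"
  have "?a \<in> disk" "?b \<in> disk" "closed_segment ?a ?b \<inter> punctures n k = {}"
    using sub[OF R(5,6)] R(2,5,6) by blast+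
  then have one: "edge ?a ?b = \<e>"
    by (intro lower_edge(2)) simp_all
  have "edge (pos i e) (pos (i + \<sigma>) e') = edge (pos i e) ?a \<cdot> edge ?a (pos (i + \<sigma>) e')"
    by (rule edge_triangle[OF R(1,2,3,5,4), symmetric])
  also have "edge ?a (pos (i + \<sigma>) e') = edge ?a ?b \<cdot> edge ?b (pos (i + \<sigma>) e')"
    by (rule edge_triangle[OF R(1,2,5,6,4), symmetric])
  also have "\<dots> = edge ?b (pos (i + \<sigma>) e')"
    unfolding one using edge_side_pos(1)[OF \<sigma>(2) ss e(2)] by simp
  finally show "edge (pos i e) (pos (i + \<sigma>) e') = edge (pos i e) ?a \<cdot> edge ?b (pos (i + \<sigma>) e')" .
qed

section \<open>The generators\<close>

lemma base_approach:
  assumes i: "i \<in> {1..int n}"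
  shows "\<exists>C. convex C \<and> C \<subseteq> punctured_disk n k \<and> base_pt \<in> C \<and> pos i (-1) \<in> C \<and>
    closed_segment base_pt (centre i) - {centre i} \<subseteq> C"
proof -
  let ?d = "pos i (-1)" and ?z = "centre i"
  have "?d \<in> punctured_disk n k" using near_in[OF i, of "-1"] by auto
  then have d: "closed_segment ?d ?d \<inter> punctures n k = {}" "?d \<in> disk" by auto
  have im: "Im ?d \<le> 0" using eps_pos by simp
  note R = lower_region[OF d(2) im d(2) im d(1)]
  have "?z \<in> disk" using eps_boundary[OF i] eps_pos by (simp add: disk_def cmod_def)
  have "closed_segment base_pt ?z - {?z} \<subseteq> lower_region ?d ?d"
  proof
    fix w assume w: "w \<in> closed_segment base_pt ?z - {?z}"
    then obtain t where t: "0 \<le> t" "t \<le> 1" "w = (1 - t) *\<^sub>R base_pt + t *\<^sub>R ?z"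
      by (auto simp: in_segment)
    then have "t \<noteq> 1" using w by auto
    then have "Im w < 0" using t by (simp add: base_pt_def)
    moreover have "w \<in> disk" using w base_in \<open>?z \<in> disk\<close>
        closed_segment_subset[of base_pt disk ?z] by (auto simp: disk_def)
    ultimately show "w \<in> lower_region ?d ?d" by (simp add: lower_region_def)
  qed
  then show ?thesis using R by blast
qed

text \<open>Together with \<open>base_approach\<close>, this provides the convex set for \<open>lasso_class_polygonal_path\<close>: the last
edge of a coded path comes from the base point or from a neighbouring puncture.\<close>

lemma link_approach:
  assumes i: "i \<in> {1..int n}" and \<sigma>: "\<bar>\<sigma>\<bar> = 1" "i + \<sigma> \<in> {1..int n}" and e: "\<bar>e\<bar> = 1"
  shows "\<exists>C. convex C \<and> C \<subseteq> punctured_disk n k \<and> pos i e \<in> C \<and> pos (i + \<sigma>) (-1) \<in> C \<and>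
    closed_segment (pos i e) (centre (i + \<sigma>)) - {centre (i + \<sigma>)} \<subseteq> C"
proof -
  let ?C = "strip i \<sigma> e (-1)" and ?z = "centre (i + \<sigma>)"
  have m1: "\<bar>-1 :: int\<bar> = 1" by simp
  note R = strip[OF i \<sigma> e m1]
  have "\<sigma> = 1 \<or> \<sigma> = -1" using \<sigma>(1) by linarith
  then have sep: "\<sigma> * k i < \<sigma> * k (i + \<sigma>)"
    using gap[OF i \<sigma>(2)] gap[OF \<sigma>(2) i] eps_pos by auto
  have "?z \<in> disk" using eps_boundary[OF \<sigma>(2)] eps_pos by (simp add: disk_def cmod_def)
  have "closed_segment (pos i e) ?z - {?z} \<subseteq> ?C"
  proof
    fix w assume w: "w \<in> closed_segment (pos i e) ?z - {?z}"
    then obtain t where t: "0 \<le> t" "t \<le> 1" "w = (1 - t) *\<^sub>R pos i e + t *\<^sub>R ?z"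
      by (auto simp: in_segment)
    then have t1: "t < 1" using w by (cases "t = 1") auto
    have "pos i e \<in> disk" "convex disk" using R(2,3) by (blast, simp add: disk_def)
    then have "w \<in> disk" using w \<open>?z \<in> disk\<close> closed_segment_subset[of "pos i e" disk ?z] by blast
    show "w \<in> ?C"
    proof (cases "t = 0")
      case True
      then show ?thesis using t(3) R(3) by simp
    next
      case False
      have re: "\<sigma> * Re w = (1 - t) * (\<sigma> * k i) + t * (\<sigma> * k (i + \<sigma>))"
        unfolding t(3) by (simp add: algebra_simps)
      have "\<sigma> * Re w - \<sigma> * k i = t * (\<sigma> * k (i + \<sigma>) - \<sigma> * k i)"
        "\<sigma> * k (i + \<sigma>) - \<sigma> * Re w = (1 - t) * (\<sigma> * k (i + \<sigma>) - \<sigma> * k i)"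
        unfolding re by (simp_all add: algebra_simps)
      moreover have "0 < t * (\<sigma> * k (i + \<sigma>) - \<sigma> * k i)" "0 < (1 - t) * (\<sigma> * k (i + \<sigma>) - \<sigma> * k i)"
        using sep t t1 False by auto
      ultimately have "0 < \<sigma> * Re w - \<sigma> * k i" "0 < \<sigma> * k (i + \<sigma>) - \<sigma> * Re w" by simp_all
      then have "\<sigma> * k i < \<sigma> * Re w" "\<sigma> * Re w < \<sigma> * k (i + \<sigma>)" by simp_all
      then show ?thesis using \<open>w \<in> disk\<close> by (simp add: strip_def lex_halfplane_def)
    qed
  qed
  then show ?thesis using R by blast
qed

lemma circle_in:
  assumes "i \<in> {1..int n}"
  shows "path_in (punctured_disk n k) (circle_at (centre i) (pos i (-1)))"
  using near_centre[of "-1" i] circle_at_image[of "pos i (-1)" "centre i" \<epsilon>] ball_in[OF assms] by auto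

lemma lasso_class_of_list:
  assumes i: "i \<in> {1..int n}"
    and vs: "vs \<noteq> []" "edges_in (punctured_disk n k) vs" "hd vs = base_pt"
    and C: "\<exists>C. convex C \<and> C \<subseteq> punctured_disk n k \<and> last vs \<in> C \<and> pos i (-1) \<in> C \<and>
      closed_segment (last vs) (centre i) - {centre i} \<subseteq> C"
  defines "X \<equiv> edge_product (vs @ [pos i (-1)])"
  shows "lasso_class (punctured_disk n k) (polygonal_path (vs @ [centre i])) =
    X \<cdot> (based (circle_at (centre i) (pos i (-1))) \<cdot> inv\<^bsub>pi1 (punctured_disk n k) base_pt\<^esub> X)"
proof -
  obtain C where C: "convex C" "C \<subseteq> punctured_disk n k" "last vs \<in> C" "pos i (-1) \<in> C"
      "closed_segment (last vs) (centre i) - {centre i} \<subseteq> C" using C by blast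
  have "pos i (-1) \<in> cball (centre i) \<epsilon>" using near_centre(1)[of "-1" i] by simp
  from lasso_class_polygonal_path[OF vs centre_not_in[OF i] eps_pos ball_in[OF i] C this]
  show ?thesis unfolding X_def .
qed

lemma std_gen_eq_circle:
  assumes i: "i \<in> {1..int n}"
  shows "std_gen n k i = based (circle_at (centre i) (pos i (-1)))"
    "std_gen n k i \<in> carrier (pi1 (punctured_disk n k) base_pt)"
proof -
  let ?d = "pos i (-1)" and ?z = "centre i"
  have d: "?d \<in> punctured_disk n k" using near_in[OF i, of "-1"] by auto
  have im: "Im ?d \<le> 0" using eps_pos by simp
  have "std_gen n k i = edge_product ([base_pt] @ [?d]) \<cdot>
      (based (circle_at ?z ?d) \<cdot> inv\<^bsub>pi1 (punctured_disk n k) base_pt\<^esub> edge_product ([base_pt] @ [?d]))"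
    using lasso_class_of_list[OF i, of "[base_pt]"] base_in base_approach[OF i]
    by (simp add: std_gen_def)
  also have "\<dots> = based (circle_at ?z ?d)"
    using base_edge(2)[OF d im] circle_in[OF i] by simp
  finally show "std_gen n k i = based (circle_at ?z ?d)" .
  then show "std_gen n k i \<in> carrier (pi1 (punctured_disk n k) base_pt)" using circle_in[OF i] by simp
qed

text \<open>The square inscribed in the circle has the vertices below, right, above and left of the
puncture; its two lower edges have trivial value.\<close>

lemma std_gen_over:
  assumes i: "i \<in> {1..int n}"
  shows "std_gen n k i = edge (side i 1) (pos i 1) \<cdot> edge (pos i 1) (side i (-1))"
proof -
  let ?d = "pos i (-1)" and ?z = "centre i"
  have d: "?d \<in> cball ?z \<epsilon>" "?d \<noteq> ?z" using near_centre[of "-1" i] by auto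
  have pts: "?z + \<i> * (?d - ?z) = side i 1" "?z - (?d - ?z) = pos i 1" "?z - \<i> * (?d - ?z) = side i (-1)"
    by (simp_all add: complex_eq_iff)
  note e1 = edge_side_pos[OF i, of 1 "-1"] and e2 = edge_side_pos[OF i, of 1 1]
    and e3 = edge_side_pos[OF i, of "-1" 1] and e4 = edge_side_pos[OF i, of "-1" "-1"]
  have "homotopic_paths (punctured_disk n k) (circle_at ?z ?d)
    (linepath ?d (side i 1) +++ (linepath (side i 1) (pos i 1) +++
      (linepath (pos i 1) (side i (-1)) +++ linepath (side i (-1)) ?d)))"
    using circle_at_square[OF d] ball_in[OF i] homotopic_paths_subset unfolding pts by blast
  then have "std_gen n k i = based (linepath ?d (side i 1) +++ (linepath (side i 1) (pos i 1) +++
      (linepath (pos i 1) (side i (-1)) +++ linepath (side i (-1)) ?d)))"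
    unfolding std_gen_eq_circle(1)[OF i] by (rule based_cong)
  also have "\<dots> = edge (side i 1) (pos i 1) \<cdot> edge (pos i 1) (side i (-1))"
    using e1 e2 e3 e4 by (simp add: based_join path_image_join)
  finally show ?thesis .
qed

end

section \<open>Coded paths without their end\<close>

text \<open>Detours and letters look at the points of the following links but not at their positions, so
replacing the last link \<open>(i,0)\<close> by \<open>(i,-1)\<close> changes neither the vertices before it nor their letters.\<close>

lemma detour_cong:
  assumes "map fst rest = map fst rest'"
  shows "detour k \<epsilon> a b rest = detour k \<epsilon> a b rest'"
proof (cases rest)
  case (Cons x xs)
  then obtain x' xs' where "rest' = x' # xs'" "fst x = fst x'" "map fst xs = map fst xs'"
    using assms by auto
  then show ?thesis using Cons
    by (cases xs; cases xs') (simp_all add: detour_def start_detour_def turn_detour_def case_prod_beta)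
qed (use assms in simp)

lemma link_letters_cong:
  assumes "map fst rest = map fst rest'"
  shows "link_letters b rest = link_letters b rest'"
proof (cases rest)
  case (Cons x xs)
  then obtain x' xs' where "rest' = x' # xs'" "fst x = fst x'" "map fst xs = map fst xs'"
    using assms by auto
  then show ?thesis using Cons
    by (cases xs; cases xs') (simp_all add: link_letters_def case_prod_beta)
qed (use assms in simp)

lemma vertices_last:
  "\<exists>vs. \<forall>e. vertices k \<epsilon> (xs @ [b, (i, e)]) = vs @ [link_pt k \<epsilon> b, link_pt k \<epsilon> (i, e)]"
proof (induction xs)
  case Nil
  have "detour k \<epsilon> b (i, e) [] = []" for e
    by (simp add: detour_def start_detour_def turn_detour_def)
  then show ?case by (intro exI[of _ "[]"]) simp
next
  case (Cons x xs)
  then obtain vs where vs: "\<And>e. vertices k \<epsilon> (xs @ [b, (i, e)]) = vs @ [link_pt k \<epsilon> b, link_pt k \<epsilon> (i, e)]"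
    by blast
  obtain y ys where y: "xs @ [b] = y # ys" by (cases "xs @ [b]") auto
  then have eq: "xs @ [b, (i, e)] = y # ys @ [(i, e)]" for e
    by (metis append_Cons append_assoc append_Nil)
  have "detour k \<epsilon> x y (ys @ [(i, e)]) = detour k \<epsilon> x y (ys @ [(i, 0)])" for e
    by (rule detour_cong) simp
  then have "vertices k \<epsilon> ((x # xs) @ [b, (i, e)]) =
      (link_pt k \<epsilon> x # detour k \<epsilon> x y (ys @ [(i, 0)]) @ vs) @ [link_pt k \<epsilon> b, link_pt k \<epsilon> (i, e)]" for e
    using vs[of e] unfolding eq append_Cons by (simp add: eq)
  then show ?case by blast
qed

lemma link_pass_last:
  assumes "i \<noteq> -1"
  shows "link_pass (xs @ [(i, 0)]) = link_pass (xs @ [(i, -1)]) @ [Gen i]"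
proof (induction xs)
  case Nil
  then show ?case using assms by (simp add: link_letters_def)
next
  case (Cons x xs)
  have "link_letters x (xs @ [(i, 0)]) = link_letters x (xs @ [(i, -1)])"
    by (rule link_letters_cong) simp
  then show ?case using Cons by simp
qed

text \<open>The side from which the path enters the surroundings of its first link, \<open>1\<close> for right and \<open>-1\<close> for
left, read off from where it goes: a single link is passed from one side to the other, and after a pair of links
over the same point the path is back on the side where it came from. At the end of the path any of
the values \<open>\<plusminus>1\<close> would serve; the value \<open>0\<close> does not occur for walks.\<close>

fun entry_side :: "link list \<Rightarrow> int" where
  "entry_side ((i, e) # (j, e') # rest) =
     (if j \<noteq> i then i - j else case rest of [] \<Rightarrow> 0 | (j', _) # _ \<Rightarrow> j' - i)"
| "entry_side _ = 1"

text \<open>The suffixes of a path code after its first link, with \<open>(i,-1)\<close> for the final \<open>(i,0)\<close>. The condition on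
\<open>entry_side\<close> says that a path coming from \<open>i\<close> enters the surroundings of \<open>j\<close> on the side of \<open>i\<close>; it combines the two
conditions of being reduced, for links with and without a change of direction.\<close>

fun walk :: "nat \<Rightarrow> link list \<Rightarrow> bool" where
  "walk n [] \<longleftrightarrow> False"
| "walk n [(j, e)] \<longleftrightarrow> j \<in> {1..int n} \<and> e = -1"
| "walk n ((i, e) # (j, e') # rest) \<longleftrightarrow> i \<in> {1..int n} \<and> \<bar>e\<bar> = 1 \<and>
     (if j = i then e' = - e \<and> rest \<noteq> [] \<and> \<bar>fst (hd rest) - i\<bar> = 1
      else \<bar>i - j\<bar> = 1 \<and> (rest \<noteq> [] \<longrightarrow> entry_side ((j, e') # rest) = i - j)) \<and>
     walk n ((j, e') # rest)"

lemma walk_head: "walk n ((i, e) # rest) \<Longrightarrow> i \<in> {1..int n} \<and> \<bar>e\<bar> = 1"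
  by (cases "(n, (i, e) # rest)" rule: walk.cases) auto

lemma abs_entry_side: "walk n M \<Longrightarrow> \<bar>entry_side M\<bar> = 1"
  by (cases "(n, M)" rule: walk.cases) (auto split: list.splits if_splits)

lemma entry_side_turn:
  "walk n ((i, e) # (i, e') # rest) \<Longrightarrow> entry_side ((i, e') # rest) = - entry_side ((i, e) # (i, e') # rest)"
  by (cases rest) auto

lemma walk_suffix: "walk n (ys @ zs) \<Longrightarrow> zs \<noteq> [] \<Longrightarrow> walk n zs"
proof (induction ys)
  case (Cons y ys)
  then show ?case by (cases "(n, y # ys @ zs)" rule: walk.cases) auto
qed simp

text \<open>By induction from the end of the list. The conditions of \<open>path_code\<close> concern up to four consecutive
links; those for the link \<open>m + 1\<close> determine on which side the path enters there.\<close>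

lemma walk_of_path_code:
  assumes L: "path_code n L" and i: "last L = (i, 0)"
  defines "L' \<equiv> butlast L @ [(i, -1)]"
  assumes m: "1 \<le> m" "m < length L"
  shows "walk n (drop m L')"
proof -
  let ?l = "length L" and ?p = "\<lambda>m. fst (L' ! m)"
  have len: "length L' = ?l" "L \<noteq> []" using m by (auto simp: L'_def)
  have nth: "L' ! m = L ! m" if "m + 1 < ?l" for m
  proof -
    have "m < length L - 1" using that by linarith
    then show ?thesis by (simp add: L'_def nth_append nth_butlast)
  qed
  have "L' ! (?l - 1) = (i, -1)" "L ! (?l - 1) = (i, 0)"
    using len i last_conv_nth[of L] by (simp_all add: L'_def nth_append)
  then have p: "?p m = fst (L ! m)" if "m < ?l" for m
    using that nth[of m] by (cases "m = ?l - 1") auto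
  note code = L[unfolded path_code_def]
  have point: "?p m \<in> {1..int n}" "\<bar>snd (L' ! m)\<bar> = 1" if "1 \<le> m" "m + 1 < ?l" for m
    using code that nth[of m] by auto
  have near: "\<bar>?p (m + 1) - ?p m\<bar> \<le> 1" if "1 \<le> m" "m + 1 < ?l" for m
    using code that p[of m] p[of "m + 1"] by auto
  have turn: "snd (L' ! (m + 1)) = - snd (L' ! m)" "m + 2 < ?l" "?p (m + 2) \<noteq> ?p m"
      "2 \<le> m \<Longrightarrow> ?p (m - 1) = ?p (m + 2)"
    if "1 \<le> m" "m + 1 < ?l" "?p (m + 1) = ?p m" for m
  proof -
    have eq: "fst (L ! (m + 1)) = fst (L ! m)" using that p[of m] p[of "m + 1"] by simp
    have c: "snd (L ! (m + 1)) = - snd (L ! m) \<and> m + 2 < ?l \<and> fst (L ! (m + 2)) \<noteq> fst (L ! m) \<and>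
        (2 \<le> m \<longrightarrow> fst (L ! (m - 1)) = fst (L ! (m + 2)))"
      using code that(1,2) eq by blast
    then show "m + 2 < ?l" by simp
    have ml: "m - 1 < ?l" using that(2) by linarith
    show "snd (L' ! (m + 1)) = - snd (L' ! m)" using c nth[of m] nth[of "m + 1"] by simp
    show "?p (m + 2) \<noteq> ?p m" using c p[of m] p[of "m + 2"] by simp
    show "2 \<le> m \<Longrightarrow> ?p (m - 1) = ?p (m + 2)" using c p[of "m - 1"] p[of "m + 2"] ml by simp
  qed
  have no_back: "?p (m - 1) \<noteq> ?p (m + 1)"
    if "2 \<le> m" "m + 1 < ?l" "?p (m - 1) \<noteq> ?p m" "?p m \<noteq> ?p (m + 1)" for m
    using code that p[of m] p[of "m + 1"] p[of "m - 1"] by auto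
  from m(2) have "m \<le> ?l - 1" by simp
  then show ?thesis using m(1)
  proof (induction rule: inc_induct)
    case base
    have "drop (?l - 1) L' = [(i, -1)]" by (simp add: L'_def)
    moreover have "i \<in> {1..int n}" using code i by auto
    ultimately show ?case by simp
  next
    case (step m)
    have m: "1 \<le> m" "m + 1 < ?l" using step by auto
    have dr: "drop j L' = L' ! j # drop (Suc j) L'" if "j < ?l" for j
      using that len by (simp add: Cons_nth_drop_Suc)
    obtain a e where a: "L' ! m = (a, e)" by fastforce
    obtain b e' where b: "L' ! (m + 1) = (b, e')" by fastforce
    let ?rest = "drop (m + 2) L'"
    have d1: "drop (Suc m) L' = (b, e') # ?rest" using dr[of "m + 1"] m b by simp
    have d0: "drop m L' = (a, e) # (b, e') # ?rest" using dr[of m] m a d1 by simp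
    have w: "walk n ((b, e') # ?rest)" using step.IH step.prems d1 by simp
    have rest: "?rest = L' ! (m + 2) # drop (m + 3) L'" if "m + 2 < ?l"
      using dr[OF that] by (simp add: numeral_eq_Suc)
    have pa: "?p m = a" "?p (m + 1) = b" using a b by auto
    have "b = a \<Longrightarrow> e' = - e \<and> ?rest \<noteq> [] \<and> \<bar>fst (hd ?rest) - a\<bar> = 1"
    proof -
      assume "b = a"
      then have t: "snd (L' ! (m + 1)) = - snd (L' ! m)" "m + 2 < ?l" "?p (m + 2) \<noteq> ?p m"
        using turn[OF m] pa by auto
      moreover have "\<bar>?p (m + 2) - ?p (m + 1)\<bar> \<le> 1" using near[of "m + 1"] t(2) by simp
      ultimately show ?thesis using a b \<open>b = a\<close> rest[OF t(2)] by (auto simp: pa)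
    qed
    moreover have "b \<noteq> a \<Longrightarrow> \<bar>a - b\<bar> = 1" using near[OF m] pa by auto
    moreover have "entry_side ((b, e') # ?rest) = a - b" if ba: "b \<noteq> a" and "?rest \<noteq> []"
    proof -
      have m2: "m + 2 < ?l" using that(2) len by simp
      obtain c e'' where c: "L' ! (m + 2) = (c, e'')" by fastforce
      have near1: "\<bar>a - b\<bar> \<le> 1" "\<bar>c - b\<bar> \<le> 1"
        using near[OF m] near[of "m + 1"] m2 pa c by auto
      show ?thesis
      proof (cases "c = b")
        case True
        then have t: "m + 3 < ?l" "a = ?p (m + 3)"
          using turn[of "m + 1"] m m2 c pa by (auto simp: numeral_eq_Suc)
        then have "drop (m + 3) L' = L' ! (m + 3) # drop (m + 4) L'"
          using dr[of "m + 3"] by (simp add: numeral_eq_Suc)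
        then show ?thesis unfolding rest[OF m2] c using True t(2)
          by (auto split: prod.splits)
      next
        case False
        then have "a \<noteq> c" using no_back[of "m + 1"] m m2 ba c pa by auto
        then show ?thesis unfolding rest[OF m2] c using False ba near1 by auto
      qed
    qed
    ultimately show ?case unfolding d0 using w point[OF m] a by auto
  qed
qed

context marked_disk begin

section \<open>The value of a coded path\<close>

abbreviation good_word :: "letter list \<Rightarrow> bool" where
  "good_word w \<equiv> letter_index ` set w \<subseteq> {1..int n}"

lemma letter_value_closed [simp]:
  "letter_index x \<in> {1..int n} \<Longrightarrow> letter_value n k x \<in> carrier (pi1 (punctured_disk n k) base_pt)"
  using std_gen_eq_circle(2) by (cases x) auto

lemma word_value_simps [simp]:
  "word_value n k [] = \<e>"
  "word_value n k (x # w) = letter_value n k x \<cdot> word_value n k w"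
  by (simp_all add: word_value_def)

lemma word_value_closed [simp]:
  "good_word w \<Longrightarrow> word_value n k w \<in> carrier (pi1 (punctured_disk n k) base_pt)"
  by (induction w) auto

lemma word_value_append:
  "good_word v \<Longrightarrow> good_word w \<Longrightarrow> word_value n k (v @ w) = word_value n k v \<cdot> word_value n k w"
  by (induction v) (auto simp: m_assoc)

lemma letter_value_inverse:
  "letter_index x \<in> {1..int n} \<Longrightarrow>
    letter_value n k (inverse_letter x) = inv\<^bsub>pi1 (punctured_disk n k) base_pt\<^esub> letter_value n k x"
  using std_gen_eq_circle(2) by (cases x) auto

lemma letter_index_inverse [simp]: "letter_index (inverse_letter x) = letter_index x"
  by (cases x) auto

lemma word_value_inverse:
  "good_word w \<Longrightarrow> word_value n k (map inverse_letter (rev w)) =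
    inv\<^bsub>pi1 (punctured_disk n k) base_pt\<^esub> word_value n k w"
proof (induction w)
  case (Cons x w)
  have "good_word (map inverse_letter (rev w))" "good_word [inverse_letter x]" using Cons by auto
  then show ?case using Cons by (simp add: word_value_append letter_value_inverse inv_mult_group)
qed simp

lemma link_pt_pos: "i \<in> {1..int n} \<Longrightarrow> link_pt k \<epsilon> (i, e) = pos i e"
  by (simp add: link_pt_def)

lemma link_letters_walk:
  assumes "walk n ((i, e) # y # rest)"
  shows "link_letters (i, e) (y # rest) =
    (if e = 1 then [if entry_side ((i, e) # y # rest) = 1 then Gen i else GenInv i] else [])"
proof -
  obtain j e' where y: "y = (j, e')" by fastforce
  have e: "e = 1 \<or> e = -1" using assms by (auto simp: y)
  show ?thesis using assms e unfolding y
    by (cases rest) (auto simp: link_letters_def abs_if split: if_splits prod.splits)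
qed

text \<open>The detour prescribed at the start of a path passes the first puncture on the side from
which the path would arrive if it came from another link.\<close>

lemma start_vertices:
  assumes "walk n ((i, e) # rest)"
  shows "vertices k \<epsilon> ((-1, 0) # (i, e) # rest) =
    base_pt # (if e = 1 then [side i (entry_side ((i, e) # rest))] else []) @ vertices k \<epsilon> ((i, e) # rest)"
proof -
  have "detour k \<epsilon> (-1, 0) (i, e) rest = (if e = 1 then [side i (entry_side ((i, e) # rest))] else [])"
  proof (cases rest)
    case Nil
    then show ?thesis using assms by (simp add: detour_def)
  next
    case (Cons y ys)
    then show ?thesis using assms
      by (cases y; cases ys)
        (auto simp: detour_def start_detour_def left_of_def right_of_def abs_if split: if_splits prod.splits)
  qed
  then show ?thesis by (simp add: link_pt_def)
qed

lemma vertices_walk: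
  assumes "walk n ((i, e) # (j, e') # rest)"
  shows "vertices k \<epsilon> ((i, e) # (j, e') # rest) =
    pos i e # (if j = i then [side i (- entry_side ((i, e) # (j, e') # rest))] else []) @
    vertices k \<epsilon> ((j, e') # rest)"
proof -
  have i: "i \<in> {1..int n}" using assms by auto
  have "detour k \<epsilon> (i, e) (j, e') rest =
      (if j = i then [side i (- entry_side ((i, e) # (j, e') # rest))] else [])"
    using assms
    by (cases rest) (auto simp: detour_def turn_detour_def left_of_def right_of_def abs_if split: if_splits prod.splits)
  then show ?thesis using i by (simp add: link_pt_pos)
qed

lemma vertices_head:
  assumes "walk n ((i, e) # rest)"
  obtains vs where "vertices k \<epsilon> ((i, e) # rest) = pos i e # vs"
  using assms walk_head[OF assms] by (cases rest) (auto simp: link_pt_pos)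

text \<open>Passing over a puncture gives the generator or its inverse, depending on the side of arrival;
passing below gives nothing.\<close>

lemma pass_value:
  assumes i: "i \<in> {1..int n}" and s: "\<bar>s\<bar> = 1" and e: "\<bar>e\<bar> = 1"
  shows "word_value n k (if e = 1 then [if s = 1 then Gen i else GenInv i] else []) =
    edge (side i s) (pos i e) \<cdot> edge (pos i e) (side i (- s))"
proof -
  have cases: "e = 1 \<or> e = -1" "s = 1 \<or> s = -1" using s e by linarith+
  have ss: "\<bar>- s\<bar> = 1" using s by simp
  note E = edge_side_pos[OF i s e] edge_side_pos[OF i ss e]
  show ?thesis
  proof (cases "e = 1")
    case False
    then have "e = -1" using cases by simp
    then show ?thesis using E(3,8) by simp
  next
    case True
    have c: "edge (side i 1) (pos i 1) \<in> carrier (pi1 (punctured_disk n k) base_pt)"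
        "edge (pos i 1) (side i (-1)) \<in> carrier (pi1 (punctured_disk n k) base_pt)"
      using edge_side_pos(1)[OF i, of 1 1] edge_side_pos(2)[OF i, of "-1" 1] by auto
    have r: "edge (side i (-1)) (pos i 1) = inv\<^bsub>pi1 (punctured_disk n k) base_pt\<^esub> edge (pos i 1) (side i (-1))"
        "edge (pos i 1) (side i 1) = inv\<^bsub>pi1 (punctured_disk n k) base_pt\<^esub> edge (side i 1) (pos i 1)"
      using edge_side_pos[OF i, of "-1" 1] edge_side_pos[OF i, of 1 1] by (intro edge_reverse; simp)+
    show ?thesis
    proof (cases "s = 1")
      case True
      then show ?thesis using \<open>e = 1\<close> std_gen_over[OF i] c by simp
    next
      case False
      then have "s = -1" using cases by simp
      then show ?thesis using \<open>e = 1\<close> std_gen_over[OF i] c r by (simp add: inv_mult_group)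
    qed
  qed
qed

text \<open>Induction over the walk. Between two links over neighbouring punctures the edge splits by
\<open>edge_between_neighbours\<close> into leaving the first puncture and arriving at the second;
at a change of direction, the detour does the same. Arriving at and leaving a link together
amount to one letter or none by \<open>pass_value\<close>. The extra factor in front is the arrival at the
first link.\<close>

lemma walk_value:
  assumes "walk n M" "M = (i, e) # rest"
  shows "edges_in (punctured_disk n k) (vertices k \<epsilon> M) \<and> good_word (link_pass M) \<and>
    edge (side i (entry_side M)) (pos i e) \<cdot> edge_product (vertices k \<epsilon> M) = word_value n k (link_pass M)"
  using assms
proof (induction M arbitrary: i e rest)
  case (Cons x M)
  show ?case
  proof (cases M)
    case Nil
    then have j: "i \<in> {1..int n}" "e = -1" using Cons.prems by auto
    then show ?thesis using Nil Cons.prems edge_side_pos(3)[OF j(1), of 1 e] near_in(1)[OF j(1), of e]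
      by (simp add: link_pt_pos link_letters_def)
  next
    case (Cons y ys)
    obtain j e' where y: "y = (j, e')" by fastforce
    let ?M = "(i, e) # (j, e') # ys" and ?N = "(j, e') # ys"
    have xM: "x # M = ?M" "M = ?N" using Cons y Cons.prems by auto
    have w: "walk n ?M" using Cons.prems(1) xM by simp
    then have wN: "walk n ?N" by simp
    have i: "i \<in> {1..int n}" "\<bar>e\<bar> = 1" using walk_head[OF w] by auto
    have j: "j \<in> {1..int n}" "\<bar>e'\<bar> = 1" using walk_head[OF wN] by auto
    define s where "s = entry_side ?M"
    define s' where "s' = entry_side ?N"
    have s: "\<bar>s\<bar> = 1" "\<bar>s'\<bar> = 1" "\<bar>- s\<bar> = 1"
      using abs_entry_side[OF w] abs_entry_side[OF wN] by (auto simp: s_def s'_def)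
    define V where "V = vertices k \<epsilon> ?N"
    have IH: "edges_in (punctured_disk n k) V" "good_word (link_pass ?N)"
      "edge (side j s') (pos j e') \<cdot> edge_product V = word_value n k (link_pass ?N)"
      using Cons.IH[of j e' ys] wN unfolding xM(2) V_def s'_def by auto
    obtain vs where V: "V = pos j e' # vs" using vertices_head[OF wN] V_def by auto
    have pass: "link_pass ?M = link_letters (i, e) ?N @ link_pass ?N" using i by simp
    have letters: "link_letters (i, e) ?N = (if e = 1 then [if s = 1 then Gen i else GenInv i] else [])"
      using link_letters_walk[OF w] by (simp add: s_def)
    have good: "good_word (link_letters (i, e) ?N)" using i unfolding letters by auto
    have goodM: "good_word (link_pass ?M)" unfolding pass using good IH(2) by (simp add: image_Un)
    have word: "word_value n k (link_pass ?M) =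
        (edge (side i s) (pos i e) \<cdot> edge (pos i e) (side i (- s))) \<cdot>
        (edge (side j s') (pos j e') \<cdot> edge_product V)"
      unfolding pass word_value_append[OF good IH(2)] IH(3)[symmetric]
      unfolding letters pass_value[OF i(1) s(1) i(2)] ..
    note segs = edge_side_pos(1)[OF i(1) s(1) i(2)] edge_side_pos(2)[OF i(1) s(3) i(2)]
      edge_side_pos(1)[OF j(1) s(2) j(2)]
    show ?thesis
    proof (cases "j = i")
      case True
      have s': "s' = - s" using entry_side_turn w unfolding True s_def s'_def by blast
      have vert: "vertices k \<epsilon> ?M = pos i e # side i (- s) # V"
        using vertices_walk[OF w] True by (simp add: V_def s_def)
      have "edges_in (punctured_disk n k) (vertices k \<epsilon> ?M)"
        unfolding vert using IH(1) segs s' True by (simp add: V)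
      moreover have "edge (side i s) (pos i e) \<cdot> edge_product (vertices k \<epsilon> ?M) = word_value n k (link_pass ?M)"
        unfolding vert word using IH(1) segs s' True by (simp add: V m_assoc)
      ultimately show ?thesis unfolding xM(1) using goodM unfolding s_def by blast
    next
      case False
      have vert: "vertices k \<epsilon> ?M = pos i e # V"
        using vertices_walk[OF w] False by (simp add: V_def)
      have ij: "i + (- s) = j" using w False by (cases ys) (auto simp: s_def)
      have move: "closed_segment (pos i e) (pos j e') \<subseteq> punctured_disk n k"
        "edge (pos i e) (pos j e') = edge (pos i e) (side i (- s)) \<cdot> edge (side j s) (pos j e')"
        using edge_between_neighbours[OF i(1) s(3) _ i(2) j(2)] unfolding ij using j(1) by simp_all
      \<comment> \<open>a walk that ends here does so below the puncture, where the side of arrival does not matter\<close>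
      have enter: "edge (side j s) (pos j e') = edge (side j s') (pos j e')"
      proof (cases ys)
        case Nil
        then have "e' = -1" using wN by simp
        then show ?thesis using edge_side_pos(3)[OF j(1)] s j(2) by simp
      next
        case (Cons a as)
        then have "s' = i - j" using w False by (simp add: s'_def)
        then show ?thesis using ij by (simp add: algebra_simps)
      qed
      have "edges_in (punctured_disk n k) (vertices k \<epsilon> ?M)"
        unfolding vert using IH(1) move(1) by (simp add: V)
      moreover have "edge (side i s) (pos i e) \<cdot> edge_product (vertices k \<epsilon> ?M) = word_value n k (link_pass ?M)"
      proof -
        have "edge_product (vertices k \<epsilon> ?M) =
            (edge (pos i e) (side i (- s)) \<cdot> edge (side j s') (pos j e')) \<cdot> edge_product V"
          unfolding vert V edge_product.simps move(2) enter ..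
        then show ?thesis unfolding word using IH(1) segs by (simp add: m_assoc)
      qed
      ultimately show ?thesis unfolding xM(1) using goodM unfolding s_def by blast
    qed
  qed
qed simp

lemma start_value:
  assumes "walk n M"
  shows "edges_in (punctured_disk n k) (vertices k \<epsilon> ((-1, 0) # M))"
    "edge_product (vertices k \<epsilon> ((-1, 0) # M)) = word_value n k (link_pass M)"
proof -
  obtain i e rest where M: "M = (i, e) # rest" using assms by (cases M) auto
  have w: "walk n ((i, e) # rest)" using assms M by simp
  have i: "i \<in> {1..int n}" "\<bar>e\<bar> = 1" using walk_head[OF w] by auto
  define s where "s = entry_side M"
  have s: "\<bar>s\<bar> = 1" using abs_entry_side[OF assms] by (simp add: s_def)
  define V where "V = vertices k \<epsilon> M"
  obtain vs where V: "V = pos i e # vs" using vertices_head[OF w] V_def M by auto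
  have val: "edges_in (punctured_disk n k) V" "edge (side i s) (pos i e) \<cdot> edge_product V = word_value n k (link_pass M)"
    using walk_value[OF assms M] by (auto simp: V_def s_def)
  have vert: "vertices k \<epsilon> ((-1, 0) # M) = base_pt # (if e = 1 then [side i s] else []) @ V"
    using start_vertices[OF w] by (simp add: M V_def s_def)
  have e: "e = 1 \<or> e = -1" using i(2) by linarith
  note segs = edge_side_pos[OF i(1) s i(2)] base_edge[OF near_in(2)[OF i(1) s]] base_edge[OF near_in(1)[OF i]]
  show "edges_in (punctured_disk n k) (vertices k \<epsilon> ((-1, 0) # M))"
    unfolding vert using e segs val(1) eps_pos by (auto simp: V)
  show "edge_product (vertices k \<epsilon> ((-1, 0) # M)) = word_value n k (link_pass M)"
    using e
  proof
    assume "e = 1"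
    then show ?thesis unfolding vert val(2)[symmetric] using segs val(1) by (simp add: V)
  next
    assume "e = -1"
    then show ?thesis unfolding vert val(2)[symmetric] using segs val(1) eps_pos by (simp add: V)
  qed
qed

text \<open>The word of \<open>path_to_syntactic\<close> has the form \<open>w \<gamma>\<^sub>i w\<inverse>\<close>, and the lasso is the conjugate
of the circle round the \<open>i\<close>-th puncture by the value of the polygon, which is that of \<open>w\<close>.\<close>

lemma lasso_class_code_path:
  assumes L: "path_code n L"
  shows "good_word (path_to_syntactic L)"
    "lasso_class (punctured_disk n k) (code_path k L \<epsilon>) = word_value n k (path_to_syntactic L)"
proof -
  obtain i where i: "i \<in> {1..int n}" "last L = (i, 0)" using L by (auto simp: path_code_def)
  have len: "2 \<le> length L" and L0: "L ! 0 = (-1, 0)" using L by (auto simp: path_code_def)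
  define xs where "xs = butlast (tl L)"
  define M where "M = xs @ [(i, -1)]"
  have Lxs: "L = (-1, 0) # xs @ [(i, 0)]"
  proof -
    have "L = (-1, 0) # tl L" using len L0 by (cases L) auto
    moreover have "tl L \<noteq> []" using len by (cases L) auto
    ultimately show ?thesis using i(2) unfolding xs_def
      by (metis append_butlast_last_id last_ConsR)
  qed
  have "butlast L @ [(i, -1)] = (-1, 0) # M" unfolding Lxs M_def by (simp add: butlast_append)
  then have M: "walk n M" using walk_of_path_code[OF L i(2), of 1] len by simp
  define w where "w = link_pass M"
  have "M = (fst (hd M), snd (hd M)) # tl M" using M by (cases M) auto
  then have good: "good_word w" using walk_value[OF M] w_def by blast
  have pass: "link_pass L = w @ [Gen i]"
    unfolding Lxs w_def M_def using link_pass_last[of i xs] i(1) by simp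
  have syn: "path_to_syntactic L = w @ [Gen i] @ map inverse_letter (rev w)"
    unfolding path_to_syntactic_def pass by (simp add: Let_def)
  have good': "good_word (map inverse_letter (rev w))" using good by auto
  show "good_word (path_to_syntactic L)" unfolding syn using good good' i(1) by (simp add: image_Un)
  let ?inv = "\<lambda>A. inv\<^bsub>pi1 (punctured_disk n k) base_pt\<^esub> A"
  define W where "W = word_value n k w"
  have W: "W \<in> carrier (pi1 (punctured_disk n k) base_pt)" using good by (simp add: W_def)
  have value_eq: "word_value n k (path_to_syntactic L) = W \<cdot> (std_gen n k i \<cdot> ?inv W)"
  proof -
    have "good_word ([Gen i] @ map inverse_letter (rev w))" using good' i(1) by simp
    then show ?thesis unfolding syn
      using good std_gen_eq_circle(2)[OF i(1)] W
      by (subst word_value_append) (simp_all add: word_value_inverse W_def)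
  qed
  obtain zs b where zs: "(-1, 0) # xs = zs @ [b]" by (metis append_butlast_last_id list.distinct(1))
  obtain vs' where "\<And>e. vertices k \<epsilon> (zs @ [b, (i, e)]) = vs' @ [link_pt k \<epsilon> b, link_pt k \<epsilon> (i, e)]"
    using vertices_last by blast
  then have vs': "vertices k \<epsilon> ((-1, 0) # xs @ [(i, e)]) = (vs' @ [link_pt k \<epsilon> b]) @ [pos i e]" for e
    using zs i(1) by (metis append_Cons append_Nil append_assoc link_pt_pos)
  define vs where "vs = vs' @ [link_pt k \<epsilon> b]"
  have vsL: "code_path k L \<epsilon> = polygonal_path (vs @ [centre i])"
    using vs'[of 0] by (simp add: code_path_def Lxs vs_def)
  have vsM: "vertices k \<epsilon> ((-1, 0) # M) = vs @ [pos i (-1)]"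
    using vs'[of "-1"] by (simp add: M_def vs_def)
  have X: "edge_product (vs @ [pos i (-1)]) = W"
    using start_value(2)[OF M] unfolding vsM W_def w_def .
  have edges: "edges_in (punctured_disk n k) vs"
    using start_value(1)[OF M] unfolding vsM by (rule edges_in_butlast)
  have vs_ne: "vs \<noteq> []" by (simp add: vs_def)
  have "M \<noteq> []" by (simp add: M_def)
  then have "hd (vertices k \<epsilon> ((-1, 0) # M)) = base_pt" by (cases M) (auto simp: link_pt_def)
  then have hd: "hd vs = base_pt" unfolding vsM using vs_ne by simp
  have "\<exists>C. convex C \<and> C \<subseteq> punctured_disk n k \<and> last vs \<in> C \<and> pos i (-1) \<in> C \<and>
      closed_segment (last vs) (centre i) - {centre i} \<subseteq> C"
  proof (cases "xs = []")
    case True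
    then have "last vs = base_pt" using zs by (simp add: vs_def link_pt_def)
    then show ?thesis using base_approach[OF i(1)] by simp
  next
    case False
    obtain j e where b: "b = (j, e)" by fastforce
    obtain ys where "xs = ys @ [b]" using zs False by (metis append_butlast_last_id last_ConsR last_snoc)
    then have "M = ys @ [(j, e), (i, -1)]" by (simp add: M_def b)
    then have w: "walk n [(j, e), (i, -1)]" using M walk_suffix by blast
    then have "\<bar>j - i\<bar> = 1" by (cases "i = j") auto
    with w have ji: "j \<in> {1..int n}" "\<bar>e\<bar> = 1" "\<bar>i - j\<bar> = 1" by auto
    have "last vs = pos j e" using ji(1) by (simp add: vs_def b link_pt_pos)
    then show ?thesis using link_approach[OF ji(1,3) _ ji(2)] i(1) by simp
  qed
  from lasso_class_of_list[OF i(1) vs_ne edges hd this]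
  show "lasso_class (punctured_disk n k) (code_path k L \<epsilon>) = word_value n k (path_to_syntactic L)"
    unfolding vsL value_eq X std_gen_eq_circle(1)[OF i(1)] .
qed

end

section \<open>Correctness of the algorithm\<close>

lemma eventually_marked_disk:
  assumes "puncture_config n k"
  shows "\<forall>\<^sub>F \<epsilon> in at_right 0. marked_disk n k \<epsilon>"
proof -
  have small: "\<forall>\<^sub>F \<epsilon> in at_right (0::real). \<epsilon> < d" if "d > 0" for d
    using that unfolding eventually_at_right_field by blast
  have mono: "strict_mono_on {1..int n} k" and inside: "\<And>i. i \<in> {1..int n} \<Longrightarrow> Complex (k i) 0 \<in> interior disk"
    using assms by (auto simp: puncture_config_def)
  have "1 - \<bar>k i\<bar> > 0" if "i \<in> {1..int n}" for i
    using inside[OF that] by (simp add: disk_def cmod_def)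
  then have "\<forall>\<^sub>F \<epsilon> in at_right 0. \<forall>i\<in>{1..int n}. \<epsilon> < 1 - \<bar>k i\<bar>"
    by (intro eventually_ball_finite) (auto intro: small)
  moreover have "(k (i + 1) - k i) / 2 > 0" if "i \<in> {1..int n}" "i + 1 \<in> {1..int n}" for i
    using strict_mono_onD[OF mono that] by simp
  then have "\<forall>\<^sub>F \<epsilon> in at_right 0. \<forall>i\<in>{i \<in> {1..int n}. i + 1 \<in> {1..int n}}. \<epsilon> < (k (i + 1) - k i) / 2"
    by (intro eventually_ball_finite ballI small finite_subset[OF _ finite_atLeastAtMost_int[of 1 "int n"]])
      blast+
  moreover have "\<forall>\<^sub>F \<epsilon> in at_right (0::real). 0 < \<epsilon>" by (rule eventually_at_right_less)
  ultimately show ?thesis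
  proof eventually_elim
    case (elim \<epsilon>)
    show ?case
    proof
      fix i assume "i \<in> {1..int n}"
      then show "\<bar>k i\<bar> + \<epsilon> \<le> 1" using elim(1) by force
      assume "i + 1 \<in> {1..int n}"
      then have "\<epsilon> < (k (i + 1) - k i) / 2" using elim(2) \<open>i \<in> {1..int n}\<close> by blast
      then show "k i + 2 * \<epsilon> < k (i + 1)" by simp
    qed (use assms elim in auto)
  qed
qed

theorem theorem3p6:
  fixes n :: nat and k :: "int \<Rightarrow> real" and L :: "link list"
  assumes "puncture_config n k"
    and "path_code n L"
    and "code_class n k L \<in> braid_images_of_gens n k"
  shows "letter_index ` set (path_to_syntactic L) \<subseteq> {1..int n} \<and>
    word_value n k (path_to_syntactic L) = code_class n k L"
proof -
  let ?W = "word_value n k (path_to_syntactic L)"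
  note ev = eventually_marked_disk[OF assms(1)]
  obtain \<epsilon> where "marked_disk n k \<epsilon>"
    using eventually_happens[OF ev] by auto
  then have good: "letter_index ` set (path_to_syntactic L) \<subseteq> {1..int n}"
    by (rule marked_disk.lasso_class_code_path(1)[OF _ assms(2)])
  have "\<forall>\<^sub>F \<epsilon> in at_right 0. lasso_class (punctured_disk n k) (code_path k L \<epsilon>) = ?W"
    using ev by eventually_elim (rule marked_disk.lasso_class_code_path(2)[OF _ assms(2)])
  then have "(\<forall>\<^sub>F \<epsilon> in at_right 0. h \<in> lasso_class (punctured_disk n k) (code_path k L \<epsilon>)) \<longleftrightarrow>
      (\<forall>\<^sub>F \<epsilon> in at_right (0::real). h \<in> ?W)" for h
    by (rule eventually_cong) auto
  then have "code_class n k L = ?W" by (simp add: code_class_def)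
  then show ?thesis using good by simp
qed

end
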